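(* Let $(\Omega,\mathcal F,\mathbb P)$ be a probability space, let $\mathfrak d,\delta,J\in\mathbb N$, let $U_{n,j}\colon\Omega\to\mathbb R^\delta$, $n\in\mathbb N_0$, $j\in\{1,\dots,J\}$, be i.i.d. random variables, let $G\colon\mathbb R^{\mathfrak d}\times\mathbb R^\delta\to\mathbb R^{\mathfrak d}$ be measurable, assume for all $\theta\in\mathbb R^{\mathfrak d}$ that $\mathbb E[\|G(\theta,U_{0,1})\|]<\infty$, let $\alpha\in[0,1)$, $\nu\in\mathbb R^{\mathfrak d}$, let $(\gamma_n)_{n\in\mathbb N_0}\subseteq(0,\infty)$, and let $\Theta,\mathbf m\colon\mathbb N_0\times\Omega\to\mathbb R^{\mathfrak d}$ be stochastic processes which satisfy for all $n\in\mathbb N$ that $$\mathbf m_0=\nu,\qquad \Theta_n=\Theta_{n-1}+\gamma_n\mathbf m_n,\qquad \mathbf m_n=\alpha\mathbf m_{n-1}+(1-\alpha)\Bigl[\frac1J\sum_{j=1}^JG(\Theta_{n-1},U_{n,j})\Bigr].$$ Assume that $\Theta_0$ and $(U_{n,j})_{n\in\mathbb N_0,\,j\in\{1,\dots,J\}}$ are independent, assume $\mathbb E[\|\Theta_0\|^2]<\infty$, for every $n\in\mathbb N_0$ let $\mathcal F_n=\sigma(\{\Theta_k\colon k\in\{0,1,\dots,n\}\})$, assume for all $n\in\mathbb N$, $j\in\{1,\dots,J\}$ that $U_{n,j}$ is independent of $\mathcal F_{n-1}$, and let $\mathfrak c\in[0,\infty)$ satisfy $\mathfrak c\ge\sup_{n\in\mathbb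 N_0}(\mathbb E[\|G(\Theta_n,U_{0,1})\|^2])^{1/2}$. Let $c\in(0,\infty)$, $\vartheta\in\mathbb R^{\mathfrak d}$ satisfy for all $\theta\in\mathbb R^{\mathfrak d}$ that $$\langle\theta-\vartheta,\mathbb E[G(\theta,U_{1,1})]\rangle\le-c\max\{\|\theta-\vartheta\|^2,\|\mathbb E[G(\theta,U_{1,1})]\|^2\}.$$ Let $\lambda\in(0,1)$, $\Gamma\in(0,\infty)$, assume for all $n\in\mathbb N$ that $\gamma_n=\Gamma n^{-\lambda}$, let $$\widehat N=\Bigl\lceil\max\Bigl\{2,\Bigl(\tfrac{2(1+\alpha)c\Gamma}{1-\alpha}\Bigr)^{1/\lambda},\Bigl(\tfrac{4\lambda}{(1-\alpha)c\Gamma}\Bigr)^{1/(1-\lambda)},\Bigl(\tfrac{2(2-\alpha)(J-1+\alpha)\Gamma}{(1-\alpha)^2c^3J}\Bigr)^{1/\lambda}\Bigr\}\Bigr\rceil,$$ and for every $n\in\mathbb N_0$ let $V_n\in[0,\infty)$ satisfy $$V_n=\mathbb E[\|\Theta_n-\vartheta\|^2]+\frac{1+\alpha}{1-\alpha}\gamma_n\max\{\mathbb E[\langle\Theta_n-\vartheta,\mathbf m_n\rangle],0\}+\frac{2}{(1-\alpha)^2}\gamma_n^2\,\mathbb E[\|\mathbf m_n\|^2].$$ Then for all $n\in\mathbb N$ with $n\ge\widehat N$ it holds that $$\mathbb E[\|\Theta_n-\vartheta\|^2]\le V_{\widehat N-1}\exp\Bigl(\frac{(1-\alpha)c\Gamma}{1-\lambda}\widehat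 N^{1-\lambda}\Bigr)\exp\Bigl(-\frac{(1-\alpha)c\Gamma}{1-\lambda}n^{1-\lambda}\Bigr)+\frac{4(2-\alpha)\Gamma\mathfrak c^2}{(1-\alpha)cJ}n^{-\lambda}.$$
   Context: $\mathbb N=\{1,2,3,\dots\}$, $\mathbb N_0=\{0,1,2,\dots\}$; $\langle\cdot,\cdot\rangle$ and $\|\cdot\|$ are the standard Euclidean inner product and norm. For a process $X\colon\mathbb N_0\times\Omega\to\mathbb R^{\mathfrak d}$, $X_n$ denotes $X(n,\cdot)$. *)

theory Defs
  imports "HOL-Probability.Probability"
begin

(* Independence is stated through indep_set on generated sigma-algebras, because
   indep_var only relates random variables with the same codomain type. *)
definition gen_sigma ::
  "'w measure \<Rightarrow> 'i set \<Rightarrow> ('i \<Rightarrow> 'w \<Rightarrow> 'b::topological_space) \<Rightarrow> 'w set set" where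
  "gen_sigma M I X =
     sigma_sets (space M) (\<Union>i\<in>I. {X i -` A \<inter> space M | A. A \<in> sets borel})"

end

theory Submission imports Defs begin

text \<open>
  Let \<open>a\<close>, \<open>b\<close>, \<open>d\<close> be the means of \<open>\<parallel>\<Theta> - \<vartheta>\<parallel>\<^sup>2\<close>, \<open>\<langle>\<Theta> - \<vartheta>, m\<rangle>\<close> and \<open>\<parallel>m\<parallel>\<^sup>2\<close>. The samples
  \<open>U\<^sub>n\<^sub>,\<^sub>j\<close> are independent of the past and of each other, so one step of the recursion
  determines the new \<open>a\<close> and \<open>b\<close> exactly and bounds the new \<open>d\<close>, with all stochastic
  gradients replaced by their means except for a variance contribution of order \<open>1 / J\<close>.
  Once the steps are small, the combination \<open>V\<close> of the three moments therefore satisfies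
  \<open>V\<^sub>n \<le> (1 - k \<gamma>\<^sub>n) V\<^sub>n\<^sub>-\<^sub>1 + (k / 2) C \<gamma>\<^sub>n\<^sup>2\<close> with \<open>k = (1 - \<alpha>) c\<close>. The first term decays like
  \<open>exp (- k \<Sum> \<gamma>)\<close>, and \<open>C \<gamma>\<^sub>n\<close> is a supersolution of the remaining recursion because
  \<open>1 / \<gamma>\<^sub>n - 1 / \<gamma>\<^sub>n\<^sub>-\<^sub>1 \<le> k / 2\<close>.
\<close>

subsection \<open>The deterministic recursion\<close>

text \<open>Here \<open>a\<close>, \<open>b\<close>, \<open>d\<close> stand for \<open>err\<close>,
  \<open>cross\<close>, \<open>mom\<close>, and \<open>h\<close>, \<open>r\<close> for
  \<open>drift\<close>, \<open>grad\<close>; primes mark the new moments, except that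
  \<open>g'\<close> is the previous step size. With \<beta> = 1 - \<alpha>, the drift contributes at
  most \<open>- (2 * \<beta> * c * g * a)\<close>: one half is the contraction of \<open>a\<close>,
  the other half absorbs the \<open>r\<close> part of \<open>d'\<close> by \<open>g2\<close>. The
  weights of \<open>b\<close> and \<open>d\<close> are such that \<open>g1\<close> and
  \<open>g \<le> g'\<close> contract these terms as well.\<close>

lemma lyapunov_step:
  fixes \<alpha> :: real
  assumes \<alpha>: "0 \<le> \<alpha>" "\<alpha> < 1" and c: "0 < c" and g: "0 < g" "g \<le> g'"
    and nn: "0 \<le> d"
    and h: "h \<le> - c * a" and r: "c\<^sup>2 * r \<le> a" "0 \<le> r"
    and a': "a' = a + 2 * g * (\<alpha> * b + (1 - \<alpha>) * h) + g\<^sup>2 * d'"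
    and b': "b' = \<alpha> * b + (1 - \<alpha>) * h + g * d'"
    and d': "0 \<le> d'" "d' \<le> \<alpha> * d + (1 - \<alpha>) * p * r + (1 - \<alpha>)\<^sup>2 * q"
    and g1: "(1 + \<alpha>) * c * g \<le> 1 - \<alpha>"
    and g2: "2 * (2 - \<alpha>) * p * g \<le> (1 - \<alpha>)\<^sup>2 * c ^ 3"
  shows "a' + (1 + \<alpha>) / (1 - \<alpha>) * g * max b' 0 + 2 / (1 - \<alpha>)\<^sup>2 * g\<^sup>2 * d'
    \<le> (1 - (1 - \<alpha>) * c * g) * (a + (1 + \<alpha>) / (1 - \<alpha>) * g' * max b 0 + 2 / (1 - \<alpha>)\<^sup>2 * g'\<^sup>2 * d)
      + 2 * (2 - \<alpha>) * g\<^sup>2 * q"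
proof -
  define \<beta> where "\<beta> = 1 - \<alpha>"
  have \<beta>: "0 < \<beta>" "\<beta> \<le> 1" and \<alpha>\<beta>: "\<alpha> = 1 - \<beta>" using \<alpha> by (auto simp: \<beta>_def)
  define B where "B = max b 0"
  have B: "b \<le> B" "0 \<le> B" by (auto simp: B_def)
  have "0 \<le> a" using r c by (meson mult_nonneg_nonneg order_trans zero_le_power2)
  then have h0: "h \<le> 0" using h c by (smt (verit) mult_nonneg_nonneg mult_minus_left)
  \<comment> \<open>Total weight of \<open>g\<^sup>2 * d'\<close> when \<open>b'\<close> is
    nonnegative: 1 + (1 + \<alpha>) / \<beta> + 2 / \<beta>^2, where the middle term comes from the
    \<open>d'\<close> inside \<open>b'\<close>.\<close>
  define D where "D = 2 * (1 + \<beta>) / \<beta>\<^sup>2"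
  have D0: "0 \<le> D" using \<beta> by (auto simp: D_def)
  have E: "a' + (1 + \<alpha>) / \<beta> * g * max b' 0 + 2 / \<beta>\<^sup>2 * g\<^sup>2 * d'
      \<le> a + 2 * g * \<beta> * h + (2 + \<beta>) / \<beta> * \<alpha> * g * B + D * g\<^sup>2 * d'"
  proof (cases "b' \<ge> 0")
    case True
    have "a' + (1 + \<alpha>) / \<beta> * g * max b' 0 + 2 / \<beta>\<^sup>2 * g\<^sup>2 * d'
      = a + (2 + \<beta>) * (g * h) + (2 + \<beta>) / \<beta> * \<alpha> * g * b + D * g\<^sup>2 * d'"
      using True \<beta> unfolding a' b' \<alpha>\<beta> D_def by (simp add: field_simps) (simp add: power2_eq_square algebra_simps)
    \<comment> \<open>The surplus of the weight 2 + \<beta> over 2 \<beta> stems from the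
      \<open>h\<close> inside \<open>b'\<close>; it has a favourable sign and is dropped.\<close>
    moreover have "(2 + \<beta>) * (g * h) \<le> 2 * \<beta> * (g * h)"
      using h0 g \<beta> by (intro mult_right_mono_neg) (auto simp: mult_nonneg_nonpos)
    moreover have "(2 + \<beta>) / \<beta> * \<alpha> * g * b \<le> (2 + \<beta>) / \<beta> * \<alpha> * g * B"
      using B \<beta> \<alpha> g by (intro mult_left_mono) auto
    ultimately show ?thesis by (simp add: ac_simps)
  next
    case False
    have "a' + (1 + \<alpha>) / \<beta> * g * max b' 0 + 2 / \<beta>\<^sup>2 * g\<^sup>2 * d'
      = a + 2 * g * \<beta> * h + 2 * \<alpha> * g * b + (1 + 2 / \<beta>\<^sup>2) * g\<^sup>2 * d'"
      using False \<beta> unfolding a' \<alpha>\<beta> by (simp add: algebra_simps)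
    moreover have "(1 + 2 / \<beta>\<^sup>2) * g\<^sup>2 * d' \<le> D * g\<^sup>2 * d'"
    proof -
      have "D = 2 / \<beta>\<^sup>2 + 2 / \<beta>" using \<beta> by (simp add: D_def field_simps power2_eq_square)
      then have "1 + 2 / \<beta>\<^sup>2 \<le> D" using \<beta> by simp
      then show ?thesis using d' by (simp add: mult_right_mono)
    qed
    moreover have "2 * \<alpha> * g * b \<le> (2 + \<beta>) / \<beta> * \<alpha> * g * B"
    proof -
      have "2 * (\<alpha> * g * b) \<le> 2 * (\<alpha> * g * B)" using B \<alpha> g by (simp add: mult_left_mono)
      also have "\<dots> \<le> (2 + \<beta>) / \<beta> * (\<alpha> * g * B)"
        using B \<alpha> g \<beta> by (intro mult_right_mono) (auto simp: field_simps)
      finally show ?thesis by (simp add: ac_simps)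
    qed
    ultimately show ?thesis by simp
  qed
  have "c * g \<le> (1 + \<alpha>) * c * g" using \<alpha> c g by (simp add: algebra_simps)
  then have cg: "c * g \<le> \<beta>" using g1 by (simp add: \<beta>_def)
  then have K0: "0 \<le> 1 - \<beta> * c * g"
    using mult_mono[of \<beta> 1 "c * g" 1] c g \<beta> by (simp add: ac_simps)
  have T1: "2 * g * \<beta> * h \<le> - (2 * \<beta> * c * g * a)"
    using mult_left_mono[OF h, of "2 * g * \<beta>"] g \<beta> by (simp add: algebra_simps)
  have T2: "(2 + \<beta>) / \<beta> * \<alpha> * g * B \<le> (1 - \<beta> * c * g) * ((1 + \<alpha>) / \<beta> * g' * B)"
  proof -
    \<comment> \<open>By \<open>g1\<close> the right side is at least (1 + \<alpha>) - \<beta>^2,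
      which equals (2 + \<beta>) \<alpha>.\<close>
    have *: "(2 + \<beta>) * \<alpha> \<le> (1 - \<beta> * c * g) * (1 + \<alpha>)"
      using mult_left_mono[OF g1, of \<beta>] \<beta> by (simp add: \<alpha>\<beta> algebra_simps)
    have "((2 + \<beta>) * \<alpha>) * (g * (B / \<beta>)) \<le> ((1 - \<beta> * c * g) * (1 + \<alpha>)) * (g' * (B / \<beta>))"
      by (rule mult_mono[OF * mult_right_mono]) (use B \<beta> g \<alpha> K0 in \<open>auto\<close>)
    then show ?thesis by (simp add: field_simps)
  qed
  have T3: "D * g\<^sup>2 * (\<alpha> * d) \<le> (1 - \<beta> * c * g) * (2 / \<beta>\<^sup>2 * g'\<^sup>2 * d)"
  proof -
    have *: "(1 + \<beta>) * \<alpha> \<le> 1 - \<beta> * c * g"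
      using mult_left_mono[OF cg, of \<beta>] \<beta> by (simp add: \<alpha>\<beta> algebra_simps)
    have "((1 + \<beta>) * \<alpha>) * (g\<^sup>2 * (2 / \<beta>\<^sup>2 * d)) \<le> (1 - \<beta> * c * g) * (g'\<^sup>2 * (2 / \<beta>\<^sup>2 * d))"
      by (rule mult_mono[OF * mult_right_mono[OF power_mono]]) (use nn \<beta> g \<alpha> K0 in \<open>auto\<close>)
    then show ?thesis by (simp add: D_def field_simps)
  qed
  have T4: "D * g\<^sup>2 * (\<beta> * p * r) \<le> \<beta> * c * g * a"
  proof -
    \<comment> \<open>The power \<open>c ^ 3\<close> is split: \<open>c\<^sup>2 * r\<close> is
      bounded by \<open>a\<close>, and the remaining \<open>c\<close> matches the drift.\<close>
    have "(2 * (1 + \<beta>) * p * g) * (g * r / \<beta>) \<le> (\<beta>\<^sup>2 * c ^ 3) * (g * r / \<beta>)"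
      using g2 g r \<beta> by (intro mult_right_mono) (auto simp: \<alpha>\<beta>)
    also have "\<dots> = \<beta> * c * g * (c\<^sup>2 * r)"
      using \<beta> by (simp add: field_simps power2_eq_square power3_eq_cube)
    also have "\<dots> \<le> \<beta> * c * g * a"
      using r g c \<beta> by (intro mult_left_mono) auto
    also have "(2 * (1 + \<beta>) * p * g) * (g * r / \<beta>) = D * g\<^sup>2 * (\<beta> * p * r)"
      using \<beta> by (simp add: D_def field_simps power2_eq_square)
    finally show ?thesis .
  qed
  have "D * g\<^sup>2 * d' \<le> D * g\<^sup>2 * (\<alpha> * d + \<beta> * p * r + \<beta>\<^sup>2 * q)"
    using d' D0 by (intro mult_left_mono) (auto simp: \<beta>_def)
  also have "\<dots> = D * g\<^sup>2 * (\<alpha> * d) + D * g\<^sup>2 * (\<beta> * p * r) + 2 * (2 - \<alpha>) * g\<^sup>2 * q"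
    using \<beta> by (simp add: D_def \<alpha>\<beta> field_simps)
  finally have "a' + (1 + \<alpha>) / \<beta> * g * max b' 0 + 2 / \<beta>\<^sup>2 * g\<^sup>2 * d'
    \<le> (1 - \<beta> * c * g) * a + (1 - \<beta> * c * g) * ((1 + \<alpha>) / \<beta> * g' * B)
      + (1 - \<beta> * c * g) * (2 / \<beta>\<^sup>2 * g'\<^sup>2 * d) + 2 * (2 - \<alpha>) * g\<^sup>2 * q"
    using E T1 T2 T3 T4 by (simp add: algebra_simps)
  then show ?thesis unfolding \<beta>_def B_def by (simp add: algebra_simps)
qed

section \<open>Gronwall estimate for polynomially decaying step sizes\<close>

lemma powr_increment_le:
  fixes p x y :: real
  assumes p: "0 < p" "p < 1" and "0 < x" "x \<le> y"
  shows "y powr p - x powr p \<le> p * x powr (p - 1) * (y - x)"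
proof (cases "x = y")
  case False
  then have xy: "x < y" using assms by simp
  have "\<exists>z>x. z < y \<and> y powr p - x powr p = (y - x) * (p * z powr (p - 1))"
    by (rule MVT2[OF xy]) (use \<open>0 < x\<close> in \<open>auto intro!: has_real_derivative_powr\<close>)
  then obtain z where z: "x < z" "z < y" "y powr p - x powr p = (y - x) * (p * z powr (p - 1))"
    by blast
  have "z powr (p - 1) \<le> x powr (p - 1)" using z p \<open>0 < x\<close> by (intro powr_mono2') auto
  then show ?thesis using z p xy by (simp add: mult_left_mono ac_simps)
qed simp

text \<open>Both \<open>V (N - 1) * e n\<close> and \<open>C * \<gamma> n\<close> are
  supersolutions, the first of the homogeneous recursion (\<open>decay\<close>) and the second of
  the one with noise (\<open>noise\<close>). The recursion is linear, so their sum dominates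
  \<open>V\<close> by induction.\<close>

lemma polynomial_step_gronwall:
  fixes V \<gamma> :: "nat \<Rightarrow> real"
  assumes lam: "0 < lam" "lam < 1" and \<Gamma>: "0 < \<Gamma>" and k: "0 < k" and C: "0 \<le> C"
    and N: "2 \<le> N" "(4 * lam / (k * \<Gamma>)) powr (1 / (1 - lam)) \<le> real N"
    and \<gamma>: "\<And>n. n \<ge> 1 \<Longrightarrow> \<gamma> n = \<Gamma> * real n powr (- lam)"
    and small: "\<And>n. n \<ge> N \<Longrightarrow> k * \<gamma> n \<le> 1"
    and V0: "\<And>n. 0 \<le> V n"
    and rec: "\<And>n. n \<ge> N \<Longrightarrow> V n \<le> (1 - k * \<gamma> n) * V (n - 1) + k / 2 * C * (\<gamma> n)\<^sup>2"
    and n: "n \<ge> N"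
  shows "V n \<le> V (N - 1) * exp (k * \<Gamma> / (1 - lam) * real N powr (1 - lam))
      * exp (- (k * \<Gamma> / (1 - lam) * real n powr (1 - lam))) + C * \<gamma> n"
proof -
  define \<kappa> where "\<kappa> = k * \<Gamma> / (1 - lam)"
  \<comment> \<open>The shift to \<open>Suc n\<close> gives \<open>e (N - 1) = 1\<close>, and the
    step into \<open>n\<close> costs the power increment from \<open>n\<close> to
    \<open>Suc n\<close>, whose bound at the left end point is exactly
    \<open>k * \<gamma> n\<close>.\<close>
  define e where "e n = exp (\<kappa> * real N powr (1 - lam)) * exp (- (\<kappa> * real (Suc n) powr (1 - lam)))" for n
  have \<kappa>: "0 < \<kappa>" using assms by (simp add: \<kappa>_def)
  have \<gamma>0: "0 < \<gamma> n" if "n \<ge> 1" for n using \<gamma>[OF that] \<Gamma> that by simp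
  \<comment> \<open>Since \<open>\<gamma>\<close> decreases, this reduces to \<open>n\<^sup>\<lambda> - (n - 1)\<^sup>\<lambda> \<le> k \<Gamma> / 2\<close>.\<close>
  have noise: "(1 - k * \<gamma> n) * \<gamma> (n - 1) + k / 2 * (\<gamma> n)\<^sup>2 \<le> \<gamma> n" if n: "n \<ge> N" for n
  proof -
    have n2: "n \<ge> 2" "n - 1 \<ge> 1" "n \<ge> 1" using n N by auto
    define P Q where "P = \<gamma> (n - 1)" and "Q = \<gamma> n"
    have PQ: "0 < P" "0 < Q" using \<gamma>0 n2 by (auto simp: P_def Q_def)
    have "Q \<le> P" unfolding P_def Q_def \<gamma>[OF n2(2)] \<gamma>[OF n2(3)] using n2 lam \<Gamma>
      by (intro mult_left_mono powr_mono2') auto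
    have "real n powr lam - real (n - 1) powr lam \<le> lam * real (n - 1) powr (lam - 1)"
      using powr_increment_le[of lam "real (n - 1)" "real n"] n2 lam by (simp add: of_nat_diff)
    \<comment> \<open>From \<open>n \<ge> 2\<close> follows n - 1 \<ge> n / 2, and the exponent is
      negative.\<close>
    also have "\<dots> \<le> lam * (real n / 2) powr (lam - 1)"
      using n2 lam by (intro mult_left_mono powr_mono2') auto
    also have "(real n / 2) powr (lam - 1) = 2 powr (1 - lam) * real n powr (lam - 1)"
      using n2 by (simp add: powr_divide powr_diff field_simps)
    also have "lam * (2 powr (1 - lam) * real n powr (lam - 1)) \<le> lam * (2 * real n powr (lam - 1))"
      using lam powr_mono[of "1 - lam" 1 2] by (intro mult_left_mono mult_right_mono) auto
    \<comment> \<open>The threshold for \<open>N\<close> enters here: its 4 is the factor 2 just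
      obtained times the denominator of \<open>k * \<Gamma> / 2\<close>.\<close>
    also have "\<dots> \<le> k * \<Gamma> / 2"
    proof -
      have "4 * lam / (k * \<Gamma>) = ((4 * lam / (k * \<Gamma>)) powr (1 / (1 - lam))) powr (1 - lam)"
        using lam k \<Gamma> by (simp add: powr_powr)
      also have "\<dots> \<le> real n powr (1 - lam)" using N n lam by (intro powr_mono2) auto
      finally have "4 * lam \<le> k * \<Gamma> * real n powr (1 - lam)" using k \<Gamma> by (simp add: field_simps)
      from mult_right_mono[OF this, of "real n powr (lam - 1)"] show ?thesis using n2
        by (simp add: mult.assoc flip: powr_add)
    qed
    finally have "\<Gamma> * real n powr lam / \<Gamma>\<^sup>2 - \<Gamma> * real (n - 1) powr lam / \<Gamma>\<^sup>2 \<le> k / 2"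
      using \<Gamma> by (simp add: field_simps power2_eq_square)
    moreover have "1 / Q = \<Gamma> * real n powr lam / \<Gamma>\<^sup>2" "1 / P = \<Gamma> * real (n - 1) powr lam / \<Gamma>\<^sup>2"
      unfolding P_def Q_def \<gamma>[OF n2(2)] \<gamma>[OF n2(3)] using \<Gamma> n2
      by (simp_all add: powr_minus field_simps power2_eq_square)
    ultimately have "1 / Q - 1 / P \<le> k / 2" by simp
    then have "P - Q \<le> k / 2 * (P * Q)" using PQ by (simp add: field_simps)
    moreover have "k / 2 * (Q * Q) \<le> k / 2 * (P * Q)"
      using \<open>Q \<le> P\<close> PQ k by (intro mult_left_mono mult_right_mono) auto
    ultimately show ?thesis unfolding P_def[symmetric] Q_def[symmetric]
      by (simp add: power2_eq_square algebra_simps)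
  qed
  have decay: "(1 - k * \<gamma> n) * e (n - 1) \<le> e n" if n: "n \<ge> N" for n
  proof -
    have n2: "n \<ge> 2" "n \<ge> 1" using n N by auto
    have "\<kappa> * (real (Suc n) powr (1 - lam) - real n powr (1 - lam)) \<le> \<kappa> * ((1 - lam) * real n powr (- lam))"
      using powr_increment_le[of "1 - lam" "real n" "real (Suc n)"] n2 lam \<kappa>
      by (intro mult_left_mono) auto
    also have "\<dots> = k * \<gamma> n" using lam \<gamma>[OF n2(2)] by (simp add: \<kappa>_def)
    finally have "exp (- k * \<gamma> n) \<le> exp (\<kappa> * real n powr (1 - lam) - \<kappa> * real (Suc n) powr (1 - lam))"
      by (simp add: algebra_simps)
    moreover have "1 - k * \<gamma> n \<le> exp (- k * \<gamma> n)" using exp_ge_add_one_self[of "- k * \<gamma> n"] by simp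
    ultimately have "1 - k * \<gamma> n \<le> exp (\<kappa> * real n powr (1 - lam) - \<kappa> * real (Suc n) powr (1 - lam))"
      by (rule order_trans[rotated])
    then have "(1 - k * \<gamma> n) * e (n - 1)
      \<le> exp (\<kappa> * real n powr (1 - lam) - \<kappa> * real (Suc n) powr (1 - lam)) * e (n - 1)"
      by (intro mult_right_mono) (auto simp: e_def)
    also have "\<dots> = e n" using n2 by (simp add: e_def flip: exp_add)
    finally show ?thesis .
  qed
  \<comment> \<open>The induction starts one index before the recursion applies, where
    \<open>e\<close> equals 1; \<open>2 \<le> N\<close> keeps \<open>\<gamma> (N - 1)\<close>
    positive there.\<close>
  have "V n \<le> V (N - 1) * e n + C * \<gamma> n" if "n \<ge> N - 1" for n
    using that
  proof (induction n rule: dec_induct)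
    case base
    have "e (N - 1) = 1" using N by (simp add: e_def flip: exp_add)
    moreover have "0 < \<gamma> (N - 1)" using N by (intro \<gamma>0) simp
    ultimately show ?case using C by simp
  next
    case (step n)
    then have n: "Suc n \<ge> N" by simp
    have "V (Suc n) \<le> (1 - k * \<gamma> (Suc n)) * V n + k / 2 * C * (\<gamma> (Suc n))\<^sup>2"
      using rec[OF n] by simp
    also have "\<dots> \<le> (1 - k * \<gamma> (Suc n)) * (V (N - 1) * e n + C * \<gamma> n) + k / 2 * C * (\<gamma> (Suc n))\<^sup>2"
      using step small[OF n] by (intro add_right_mono mult_left_mono) auto
    also have "\<dots> = V (N - 1) * ((1 - k * \<gamma> (Suc n)) * e n)
        + C * ((1 - k * \<gamma> (Suc n)) * \<gamma> n + k / 2 * (\<gamma> (Suc n))\<^sup>2)"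
      by (simp add: algebra_simps)
    also have "\<dots> \<le> V (N - 1) * e (Suc n) + C * \<gamma> (Suc n)"
      using decay[OF n] noise[OF n] V0 C by (intro add_mono mult_left_mono) auto
    finally show ?case .
  qed
  from this[of n] have "V n \<le> V (N - 1) * e n + C * \<gamma> n" using n by simp
  \<comment> \<open>Removing the shift in \<open>e\<close> only enlarges the exponential.\<close>
  also have "V (N - 1) * e n \<le> V (N - 1) *
      (exp (\<kappa> * real N powr (1 - lam)) * exp (- (\<kappa> * real n powr (1 - lam))))"
    unfolding e_def using V0 \<kappa> lam by (intro mult_left_mono) (auto intro!: powr_mono2)
  finally show ?thesis by (simp add: \<kappa>_def)
qed

subsection \<open>Square integrability and independence\<close>

lemma gen_sigma_subset_Pow: "gen_sigma M I X \<subseteq> Pow (space M)"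
proof -
  have "(\<Union>i\<in>I. {X i -` A \<inter> space M | A. A \<in> sets borel}) \<subseteq> Pow (space M)" by auto
  from sigma_sets_into_sp[OF this] show ?thesis unfolding gen_sigma_def by blast
qed

text \<open>Measurability is demanded separately because integrability of the squared norm does not
  make \<open>f\<close> itself measurable.\<close>

definition sq_integrable :: "'w measure \<Rightarrow> ('w \<Rightarrow> 'a::euclidean_space) \<Rightarrow> bool" where
  "sq_integrable M f \<longleftrightarrow> f \<in> borel_measurable M \<and> integrable M (\<lambda>x. (norm (f x))\<^sup>2)"

lemma sq_integrable_bound:
  assumes "g \<in> borel_measurable M" "integrable M f" "\<And>x. x \<in> space M \<Longrightarrow> (norm (g x))\<^sup>2 \<le> f x"
  shows "sq_integrable M g"
  unfolding sq_integrable_def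
proof
  show "integrable M (\<lambda>x. (norm (g x))\<^sup>2)"
    by (rule Bochner_Integration.integrable_bound[OF assms(2)])
       (use assms in \<open>auto intro!: AE_I2 order_trans[OF assms(3) abs_ge_self]\<close>)
qed fact

text \<open>The recursions for \<open>Th\<close> and \<open>m\<close> hold only on
  \<open>space M\<close>; this transfers integrability from their right-hand sides.\<close>

lemma sq_integrable_cong:
  assumes f: "sq_integrable M f" and eq: "\<And>x. x \<in> space M \<Longrightarrow> h x = f x"
  shows "sq_integrable M h"
proof -
  have "h \<in> borel_measurable M \<longleftrightarrow> f \<in> borel_measurable M"
    by (rule measurable_cong) (rule eq)
  moreover have "integrable M (\<lambda>x. (norm (h x))\<^sup>2) \<longleftrightarrow> integrable M (\<lambda>x. (norm (f x))\<^sup>2)"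
    by (rule Bochner_Integration.integrable_cong) (simp_all add: eq)
  ultimately show ?thesis using f unfolding sq_integrable_def by blast
qed

lemma sq_integrable_add:
  assumes "sq_integrable M f" "sq_integrable M g"
  shows "sq_integrable M (\<lambda>x. f x + g x)"
proof (rule sq_integrable_bound)
  show "integrable M (\<lambda>x. 2 * (norm (f x))\<^sup>2 + 2 * (norm (g x))\<^sup>2)"
    using assms by (auto simp: sq_integrable_def)
  fix x
  have "(norm (f x + g x))\<^sup>2 \<le> (norm (f x) + norm (g x))\<^sup>2"
    by (intro power_mono norm_triangle_ineq) auto
  also have "\<dots> \<le> 2 * (norm (f x))\<^sup>2 + 2 * (norm (g x))\<^sup>2"
    using sum_squares_bound[of "norm (f x)" "norm (g x)"] by (simp add: power2_sum)
  finally show "(norm (f x + g x))\<^sup>2 \<le> 2 * (norm (f x))\<^sup>2 + 2 * (norm (g x))\<^sup>2" .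
qed (use assms in \<open>auto simp: sq_integrable_def\<close>)

lemma sq_integrable_scaleR:
  assumes "sq_integrable M f"
  shows "sq_integrable M (\<lambda>x. (r::real) *\<^sub>R f x)"
  using assms by (auto simp: sq_integrable_def power_mult_distrib)

lemma sq_integrable_sum:
  assumes "\<And>i. i \<in> I \<Longrightarrow> sq_integrable M (f i)"
  shows "sq_integrable M (\<lambda>x. \<Sum>i\<in>I. f i x)"
  using assms
  by (induction I rule: infinite_finite_induct)
     (auto intro: sq_integrable_add simp: sq_integrable_def[of _ "\<lambda>_. 0"])

lemma integrable_inner_sq_integrable:
  assumes "sq_integrable M f" "sq_integrable M g"
  shows "integrable M (\<lambda>x. f x \<bullet> g x)"
proof (rule Bochner_Integration.integrable_bound)
  show "integrable M (\<lambda>x. (norm (f x))\<^sup>2 + (norm (g x))\<^sup>2)"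
    using assms by (auto simp: sq_integrable_def)
  have "\<bar>f x \<bullet> g x\<bar> \<le> (norm (f x))\<^sup>2 + (norm (g x))\<^sup>2" for x
    using Cauchy_Schwarz_ineq2[of "f x" "g x"] sum_squares_bound[of "norm (f x)" "norm (g x)"]
      mult_nonneg_nonneg[OF norm_ge_zero[of "f x"] norm_ge_zero[of "g x"]] by linarith
  then show "AE x in M. norm (f x \<bullet> g x) \<le> norm ((norm (f x))\<^sup>2 + (norm (g x))\<^sup>2)"
    by (auto intro!: AE_I2)
qed (use assms in \<open>auto simp: sq_integrable_def\<close>)

lemma norm_lincomb_sq:
  fixes x y :: "'a::real_inner"
  shows "(norm (r *\<^sub>R x + s *\<^sub>R y))\<^sup>2 = r\<^sup>2 * (norm x)\<^sup>2 + 2 * r * s * (x \<bullet> y) + s\<^sup>2 * (norm y)\<^sup>2"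
  unfolding power2_norm_eq_inner
  by (simp add: inner_add_left inner_add_right inner_commute[of y x] power2_eq_square algebra_simps)

text \<open>The two measures agree on rectangles by the product formula for \<open>A\<close> and
  \<open>B\<close>. Since only preimages matter, \<open>X\<close> may later be any vector of past
  variables.\<close>

lemma (in prob_space) distr_Pair_indep_set:
  assumes [measurable]: "X \<in> M \<rightarrow>\<^sub>M S" "Y \<in> M \<rightarrow>\<^sub>M T"
    and ind: "indep_set A B"
    and A: "\<And>a. a \<in> sets S \<Longrightarrow> X -` a \<inter> space M \<in> A"
    and B: "\<And>b. b \<in> sets T \<Longrightarrow> Y -` b \<inter> space M \<in> B"
  shows "distr M (S \<Otimes>\<^sub>M T) (\<lambda>\<omega>. (X \<omega>, Y \<omega>)) = distr M S X \<Otimes>\<^sub>M distr M T Y"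
proof (rule sym, rule pair_measure_eqI)
  interpret X: prob_space "distr M S X" by (rule prob_space_distr) simp
  interpret Y: prob_space "distr M T Y" by (rule prob_space_distr) simp
  show "sigma_finite_measure (distr M S X)" "sigma_finite_measure (distr M T Y)" by unfold_locales
  show "sets (distr M S X \<Otimes>\<^sub>M distr M T Y) = sets (distr M (S \<Otimes>\<^sub>M T) (\<lambda>\<omega>. (X \<omega>, Y \<omega>)))" by simp
  fix a b assume "a \<in> sets (distr M S X)" "b \<in> sets (distr M T Y)"
  then have [measurable]: "a \<in> sets S" "b \<in> sets T" by auto
  have "(\<lambda>\<omega>. (X \<omega>, Y \<omega>)) -` (a \<times> b) \<inter> space M = (X -` a \<inter> space M) \<inter> (Y -` b \<inter> space M)" by auto
  then show "emeasure (distr M S X) a * emeasure (distr M T Y) b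
      = emeasure (distr M (S \<Otimes>\<^sub>M T) (\<lambda>\<omega>. (X \<omega>, Y \<omega>))) (a \<times> b)"
    using indep_setD[OF ind A B, of a b]
    by (simp add: emeasure_distr emeasure_eq_measure flip: ennreal_mult')
qed

text \<open>The freezing lemma: Fubini under the product law averages over \<open>Y\<close> while
  \<open>X\<close> is held fixed.\<close>

lemma (in prob_space) expectation_product_law:
  fixes f :: "_ \<Rightarrow> real"
  assumes [measurable]: "X \<in> M \<rightarrow>\<^sub>M S" "Y \<in> M \<rightarrow>\<^sub>M T" "f \<in> borel_measurable (S \<Otimes>\<^sub>M T)"
    and eq: "distr M (S \<Otimes>\<^sub>M T) (\<lambda>\<omega>. (X \<omega>, Y \<omega>)) = distr M S X \<Otimes>\<^sub>M distr M T Y"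
    and int: "integrable M (\<lambda>\<omega>. f (X \<omega>, Y \<omega>))"
  shows "(\<integral>\<omega>. f (X \<omega>, Y \<omega>) \<partial>M) = (\<integral>\<omega>. (\<integral>y. f (X \<omega>, y) \<partial>distr M T Y) \<partial>M)"
proof -
  interpret X: prob_space "distr M S X" by (rule prob_space_distr) simp
  interpret Y: prob_space "distr M T Y" by (rule prob_space_distr) simp
  interpret XY: pair_prob_space "distr M S X" "distr M T Y" ..
  have "integrable (distr M S X \<Otimes>\<^sub>M distr M T Y) f"
    unfolding eq[symmetric] by (subst integrable_distr_eq) (use int in auto)
  from XY.integral_fst'[OF this]
  have "(\<integral>x. (\<integral>y. f (x, y) \<partial>distr M T Y) \<partial>distr M S X) = (\<integral>\<omega>. f (X \<omega>, Y \<omega>) \<partial>M)"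
    unfolding eq[symmetric] by (subst (asm) (3) integral_distr) auto
  moreover have "(\<lambda>x. \<integral>y. f (x, y) \<partial>distr M T Y) \<in> borel_measurable S"
    by (rule Y.borel_measurable_lebesgue_integral) (simp add: measurable_split_conv)
  ultimately show ?thesis by (simp add: integral_distr)
qed

text \<open>For \<open>a\<close>, \<open>b\<close>, \<open>z\<close> in \<open>A\<close>,
  \<open>B\<close>, \<open>C\<close>, independence of \<open>A\<close> and \<open>D\<close> splits
  \<open>a\<close> from the single event \<open>b \<inter> z\<close>, and independence of
  \<open>B\<close> and \<open>C\<close> splits the latter. The extension to generated sigma-algebras
  is the pi-lambda argument.\<close>

lemma (in prob_space) indep_set_Un_sigma:
  assumes AD: "indep_set A D" and BC: "indep_set B C"
    and st: "Int_stable A" "Int_stable B" "Int_stable C"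
    and BCD: "\<And>b c. b \<in> B \<Longrightarrow> c \<in> C \<Longrightarrow> b \<inter> c \<in> D" and BD: "B \<subseteq> D"
    and top: "space M \<in> A" "space M \<in> B"
  shows "indep_set (sigma_sets (space M) (A \<union> B)) (sigma_sets (space M) C)"
proof -
  \<comment> \<open>Unlike the union of \<open>A\<close> and \<open>B\<close>, these intersections
    form a generator stable under intersection; \<open>top\<close> ensures that they include both
    families.\<close>
  define E where "E = {a \<inter> b | a b. a \<in> A \<and> b \<in> B}"
  have ev: "A \<subseteq> events" "B \<subseteq> events" "C \<subseteq> events"
    using AD BC by (auto simp: indep_set_def indep_sets_def split: bool.splits)
  have st': "Int_stable E"
    unfolding Int_stable_def
  proof safe
    fix x y assume "x \<in> E" "y \<in> E"
    then obtain a b a' b' where *: "x = a \<inter> b" "y = a' \<inter> b'" "a \<in> A" "a' \<in> A" "b \<in> B" "b' \<in> B"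
      by (auto simp: E_def)
    then have "a \<inter> a' \<in> A" "b \<inter> b' \<in> B" using st by (auto simp: Int_stable_def)
    moreover have "x \<inter> y = (a \<inter> a') \<inter> (b \<inter> b')" using * by auto
    ultimately show "x \<inter> y \<in> E" unfolding E_def by blast
  qed
  have "indep_set E C"
  proof (rule indep_setI)
    show "E \<subseteq> events" "C \<subseteq> events" using ev by (auto simp: E_def)
    fix x z assume "x \<in> E" and z: "z \<in> C"
    then obtain a b where ab: "x = a \<inter> b" "a \<in> A" "b \<in> B" by (auto simp: E_def)
    have "prob (x \<inter> z) = prob (a \<inter> (b \<inter> z))" using ab by (simp add: Int_assoc)
    also have "\<dots> = prob a * (prob b * prob z)"
      using indep_setD[OF AD ab(2) BCD[OF ab(3) z]] indep_setD[OF BC ab(3) z] by simp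
    also have "\<dots> = prob x * prob z" using indep_setD[OF AD ab(2)] ab BD by (simp add: subset_iff)
    finally show "prob (x \<inter> z) = prob x * prob z" .
  qed
  then have "indep_set (sigma_sets (space M) E) (sigma_sets (space M) C)"
    by (rule indep_set_sigma_sets) (use st st' in auto)
  moreover have "sigma_sets (space M) (A \<union> B) = sigma_sets (space M) E"
  proof (rule sigma_sets_eqI)
    fix x assume "x \<in> A \<union> B"
    then have "x \<in> E"
    proof
      assume "x \<in> A"
      moreover then have "x = x \<inter> space M" using ev sets.sets_into_space by blast
      ultimately show ?thesis unfolding E_def using top by blast
    next
      assume "x \<in> B"
      moreover then have "x = space M \<inter> x" using ev sets.sets_into_space by blast
      ultimately show ?thesis unfolding E_def using top by blast
    qed
    then show "x \<in> sigma_sets (space M) E" by auto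
  next
    fix x assume "x \<in> E"
    then obtain a b where ab: "x = a \<inter> b" "a \<in> A" "b \<in> B" by (auto simp: E_def)
    have "A \<union> B \<subseteq> Pow (space M)" using ev sets.sets_into_space by blast
    then interpret S: sigma_algebra "space M" "sigma_sets (space M) (A \<union> B)"
      by (rule sigma_algebra_sigma_sets)
    show "x \<in> sigma_sets (space M) (A \<union> B)" using ab by auto
  qed
  ultimately show ?thesis by simp
qed

subsection \<open>Moments of the momentum iteration\<close>

locale momentum_sgd = prob_space M for M :: "'w measure" +
  fixes J :: nat
    and U :: "nat \<Rightarrow> nat \<Rightarrow> 'w \<Rightarrow> real ^ 'e"
    and G :: "real ^ 'd \<Rightarrow> real ^ 'e \<Rightarrow> real ^ 'd"
    and \<alpha> :: real
    and \<nu> :: "real ^ 'd"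
    and \<gamma> :: "nat \<Rightarrow> real"
    and Th m :: "nat \<Rightarrow> 'w \<Rightarrow> real ^ 'd"
    and cc c :: real
    and vartheta :: "real ^ 'd"
  assumes J: "J \<ge> 1"
    and U_indep: "indep_vars (\<lambda>_. borel) (\<lambda>(n, j). U n j) (UNIV \<times> {1..J})"
    and U_ident: "\<And>n j. j \<in> {1..J} \<Longrightarrow> distr M borel (U n j) = distr M borel (U 0 1)"
    and G_meas [measurable]: "(\<lambda>(\<theta>, u). G \<theta> u) \<in> borel_measurable (borel \<Otimes>\<^sub>M borel)"
    and G_int: "\<And>\<theta>. integrable M (\<lambda>\<omega>. norm (G \<theta> (U 0 1 \<omega>)))"
    and Th0_meas: "Th 0 \<in> borel_measurable M"
    and m_0: "\<And>\<omega>. \<omega> \<in> space M \<Longrightarrow> m 0 \<omega> = \<nu>"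
    and Th_rec: "\<And>n \<omega>. n \<ge> 1 \<Longrightarrow> \<omega> \<in> space M \<Longrightarrow>
          Th n \<omega> = Th (n - 1) \<omega> + \<gamma> n *\<^sub>R m n \<omega>"
    and m_rec: "\<And>n \<omega>. n \<ge> 1 \<Longrightarrow> \<omega> \<in> space M \<Longrightarrow>
          m n \<omega> = \<alpha> *\<^sub>R m (n - 1) \<omega>
            + (1 - \<alpha>) *\<^sub>R ((1 / real J) *\<^sub>R (\<Sum>j = 1..J. G (Th (n - 1) \<omega>) (U n j \<omega>)))"
    and Th0_indep: "indep_set
          (gen_sigma M {0} Th) (gen_sigma M (UNIV \<times> {1..J}) (\<lambda>(n, j). U n j))"
    and Th0_sq: "integrable M (\<lambda>\<omega>. (norm (Th 0 \<omega>))\<^sup>2)"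
    and cc_sq: "\<And>n. integrable M (\<lambda>\<omega>. (norm (G (Th n \<omega>) (U 0 1 \<omega>)))\<^sup>2)"
    and cc_bound: "\<And>n. sqrt (\<integral>\<omega>. (norm (G (Th n \<omega>) (U 0 1 \<omega>)))\<^sup>2 \<partial>M) \<le> cc"
    and c_pos: "c > 0"
    and coercive: "\<And>\<theta>. (\<theta> - vartheta) \<bullet> (\<integral>\<omega>. G \<theta> (U 1 1 \<omega>) \<partial>M)
          \<le> - c * max ((norm (\<theta> - vartheta))\<^sup>2) ((norm (\<integral>\<omega>. G \<theta> (U 1 1 \<omega>) \<partial>M))\<^sup>2)"
begin

section \<open>The mean gradient and its bounds\<close>

definition law :: "(real ^ 'e) measure" where
  "law = distr M borel (U 0 1)"

text \<open>Integrating over the common law makes one function serve every sample;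
  \<open>expectation_G\<close> identifies it with the mean in \<open>coercive\<close>.\<close>

definition g :: "real ^ 'd \<Rightarrow> real ^ 'd" where
  "g \<theta> = (\<integral>u. G \<theta> u \<partial>law)"

text \<open>
  The random variables \<open>\<Theta>\<^sub>0\<close> and \<open>U\<^sub>k\<close>, \<open>k \<in> K\<close>, generate \<open>past K\<close>. Conditioning on
  \<open>\<Theta>\<^sub>0, \<dots>, \<Theta>\<^sub>n\<close> alone would not suffice for the mixed terms of a mini-batch, where one of
  the samples of step \<open>n + 1\<close> has to be counted as past.
\<close>

definition past :: "(nat \<times> nat) set \<Rightarrow> 'w measure" where
  "past K = sigma (space M) (gen_sigma M {0} Th \<union> gen_sigma M K (\<lambda>(n, j). U n j))"

lemma U_meas [measurable]: "j \<in> {1..J} \<Longrightarrow> U n j \<in> borel_measurable M"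
  using U_indep unfolding indep_vars_def by force

lemma G_measurable [measurable (raw)]:
  assumes [measurable]: "f \<in> borel_measurable N" "h \<in> borel_measurable N"
  shows "(\<lambda>x. G (f x) (h x)) \<in> borel_measurable N"
  using measurable_compose[OF measurable_Pair[OF assms] G_meas] by simp

lemma sets_law [measurable_cong]: "sets law = sets borel"
  by (simp add: law_def)

lemma distr_U: "j \<in> {1..J} \<Longrightarrow> distr M borel (U n j) = law"
  unfolding law_def by (rule U_ident)

lemma prob_space_law: "prob_space law"
  unfolding law_def using J by (intro prob_space_distr U_meas) auto

lemma integrable_G: "integrable law (G \<theta>)"
proof -
  have "integrable M (\<lambda>\<omega>. G \<theta> (U 0 1 \<omega>))"
    by (subst integrable_norm_iff[symmetric]) (use J G_int in auto)
  then show ?thesis unfolding law_def using J by (subst integrable_distr_eq) auto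
qed

lemma g_measurable [measurable]: "g \<in> borel_measurable borel"
proof -
  interpret L: prob_space law by (rule prob_space_law)
  show ?thesis unfolding g_def by measurable
qed

lemma expectation_G: "(\<integral>\<omega>. G \<theta> (U 1 1 \<omega>) \<partial>M) = g \<theta>"
proof -
  have "1 \<in> {1..J}" using J by simp
  then show ?thesis unfolding g_def distr_U[OF \<open>1 \<in> {1..J}\<close>, of 1, symmetric]
    by (intro integral_distr[symmetric]) measurable
qed

lemma inner_g_le:
  "(\<theta> - vartheta) \<bullet> g \<theta> \<le> - c * (norm (\<theta> - vartheta))\<^sup>2"
proof -
  have "c * (norm (\<theta> - vartheta))\<^sup>2 \<le> c * max ((norm (\<theta> - vartheta))\<^sup>2) ((norm (g \<theta>))\<^sup>2)"
    using c_pos by (intro mult_left_mono) auto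
  then show ?thesis using coercive[of \<theta>, unfolded expectation_G] by simp
qed

text \<open>The second entry of the maximum in \<open>coercive\<close> and Cauchy-Schwarz bound c
  |g|^2 by |\<theta> - vartheta| |g|, and a nonzero factor |g| cancels.\<close>

lemma norm_g_le: "c * norm (g \<theta>) \<le> norm (\<theta> - vartheta)"
proof (cases "g \<theta> = 0")
  case False
  have "c * (norm (g \<theta>))\<^sup>2 \<le> c * max ((norm (\<theta> - vartheta))\<^sup>2) ((norm (g \<theta>))\<^sup>2)"
    using c_pos by (intro mult_left_mono) auto
  also have "\<dots> \<le> - ((\<theta> - vartheta) \<bullet> g \<theta>)" using coercive[of \<theta>, unfolded expectation_G] by simp
  also have "\<dots> \<le> norm (\<theta> - vartheta) * norm (g \<theta>)"
    using Cauchy_Schwarz_ineq2[of "\<theta> - vartheta" "g \<theta>"] by linarith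
  finally show ?thesis using False by (simp add: power2_eq_square)
qed simp

section \<open>Adaptedness and fresh samples\<close>

lemma gen_sigma_Pow:
  "gen_sigma M {0} Th \<union> gen_sigma M K (\<lambda>(n, j). U n j) \<subseteq> Pow (space M)"
  by (intro Un_least gen_sigma_subset_Pow)

lemma sets_past:
  "sets (past K) = sigma_sets (space M) (gen_sigma M {0} Th \<union> gen_sigma M K (\<lambda>(n, j). U n j))"
  unfolding past_def using gen_sigma_Pow by (rule sets_measure_of)

lemma space_past: "space (past K) = space M"
  unfolding past_def using gen_sigma_Pow by (rule space_measure_of)

lemma past_mono:
  assumes "f \<in> past K \<rightarrow>\<^sub>M N" "K \<subseteq> L"
  shows "f \<in> past L \<rightarrow>\<^sub>M N"
proof -
  have "sets (past K) \<subseteq> sets (past L)"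
    unfolding sets_past gen_sigma_def
    by (intro sigma_sets_mono' Un_mono UN_mono order_refl sigma_sets_mono' assms(2))
  then show ?thesis
    using assms(1) measurable_mono[of N N "past K" "past L"] by (auto simp: space_past)
qed

lemma U_past:
  assumes "(n, j) \<in> K"
  shows "U n j \<in> past K \<rightarrow>\<^sub>M borel"
proof (rule measurableI)
  fix A :: "(real ^ 'e) set" assume "A \<in> sets borel"
  then have "U n j -` A \<inter> space M \<in> gen_sigma M K (\<lambda>(n, j). U n j)"
    unfolding gen_sigma_def using assms by (intro sigma_sets.Basic) (auto intro!: bexI[of _ "(n, j)"])
  then show "U n j -` A \<inter> space (past K) \<in> sets (past K)" by (simp add: sets_past space_past)
qed simp

lemma Th0_past: "Th 0 \<in> past K \<rightarrow>\<^sub>M borel"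
proof (rule measurableI)
  fix A :: "(real ^ 'd) set" assume "A \<in> sets borel"
  then have "Th 0 -` A \<inter> space M \<in> gen_sigma M {0} Th"
    unfolding gen_sigma_def by (intro sigma_sets.Basic) auto
  then show "Th 0 -` A \<inter> space (past K) \<in> sets (past K)" by (simp add: sets_past space_past)
qed simp

text \<open>Adaptedness, by unrolling the recursion. Samples of index 0 never enter, so
  \<open>U 0 1\<close> is fresh for every \<open>Th n\<close>.\<close>

lemma Th_m_past:
  "Th n \<in> past ({1..n} \<times> {1..J}) \<rightarrow>\<^sub>M borel" "m n \<in> past ({1..n} \<times> {1..J}) \<rightarrow>\<^sub>M borel"
proof (induction n)
  case 0
  have "m 0 \<in> past K \<rightarrow>\<^sub>M borel \<longleftrightarrow> (\<lambda>_. \<nu>) \<in> past K \<rightarrow>\<^sub>M borel" for K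
    by (rule measurable_cong) (simp add: space_past m_0)
  then show "Th 0 \<in> past ({1..0} \<times> {1..J}) \<rightarrow>\<^sub>M borel" "m 0 \<in> past ({1..0} \<times> {1..J}) \<rightarrow>\<^sub>M borel"
    using Th0_past by simp_all
next
  case (Suc n)
  let ?P = "past ({1..Suc n} \<times> {1..J})"
  have [measurable]: "Th n \<in> ?P \<rightarrow>\<^sub>M borel" "m n \<in> ?P \<rightarrow>\<^sub>M borel"
    by (rule past_mono[OF Suc(1)] past_mono[OF Suc(2)]; force)+
  have [measurable]: "U (Suc n) j \<in> ?P \<rightarrow>\<^sub>M borel" if "j \<in> {1..J}" for j
    using that by (intro U_past) auto
  have *: "m (Suc n) \<in> ?P \<rightarrow>\<^sub>M borel \<longleftrightarrow> (\<lambda>\<omega>. \<alpha> *\<^sub>R m n \<omega>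
            + (1 - \<alpha>) *\<^sub>R ((1 / real J) *\<^sub>R (\<Sum>j = 1..J. G (Th n \<omega>) (U (Suc n) j \<omega>)))) \<in> ?P \<rightarrow>\<^sub>M borel"
    by (rule measurable_cong) (simp add: space_past m_rec)
  show [measurable]: "m (Suc n) \<in> ?P \<rightarrow>\<^sub>M borel" by (subst *) measurable
  have *: "Th (Suc n) \<in> ?P \<rightarrow>\<^sub>M borel \<longleftrightarrow> (\<lambda>\<omega>. Th n \<omega> + \<gamma> (Suc n) *\<^sub>R m (Suc n) \<omega>) \<in> ?P \<rightarrow>\<^sub>M borel"
    by (rule measurable_cong) (simp add: space_past Th_rec)
  show "Th (Suc n) \<in> ?P \<rightarrow>\<^sub>M borel" by (subst *) measurable
qed

lemma Int_stable_gen_sigma: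
  "Int_stable (gen_sigma M {0} Th)" "Int_stable (gen_sigma M K (\<lambda>(n, j). U n j))"
proof -
  have A: "Int_stable (sigma_sets (space M) S)" if "S \<subseteq> Pow (space M)" for S
  proof -
    interpret S: sigma_algebra "space M" "sigma_sets (space M) S"
      by (rule sigma_algebra_sigma_sets[OF that])
    show ?thesis by (auto simp: Int_stable_def)
  qed
  show "Int_stable (gen_sigma M {0} Th)" "Int_stable (gen_sigma M K (\<lambda>(n, j). U n j))"
    unfolding gen_sigma_def by (rule A; auto)+
qed

text \<open>Grouping the independent samples separates \<open>K\<close> from \<open>(n, j)\<close>,
  and \<open>Th 0\<close> is independent of all samples jointly; \<open>indep_set_Un_sigma\<close>
  merges the two facts.\<close>

lemma indep_set_past:
  assumes K: "K \<subseteq> UNIV \<times> {1..J}" and i: "j \<in> {1..J}" "(n, j) \<notin> K"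
  shows "indep_set (sets (past K)) (sigma_sets (space M) {U n j -` A \<inter> space M | A. A \<in> sets borel})"
proof -
  let ?I = "UNIV \<times> {1..J} :: (nat \<times> nat) set"
  define S where "S L = gen_sigma M L (\<lambda>(n, j). U n j)" for L
  define E where "E = (\<lambda>(n, j). {U n j -` A \<inter> space M | A. A \<in> sets borel})"
  have S: "S L = sigma_sets (space M) (\<Union>i\<in>L. E i)" for L
    unfolding S_def gen_sigma_def E_def by (simp add: case_prod_unfold)
  have SPow: "(\<Union>i\<in>L. E i) \<subseteq> Pow (space M)" for L by (auto simp: E_def)
  have "indep_sets (\<lambda>i. {(\<lambda>(n, j). U n j) i -` A \<inter> space M | A. A \<in> sets borel}) ?I"
    using U_indep unfolding indep_vars_def2 by blast
  then have indE: "indep_sets E ?I" by (simp add: E_def case_prod_unfold)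
  \<comment> \<open>Two blocks indexed by \<open>bool\<close>, the form in which
    \<open>indep_set\<close> is an instance of \<open>indep_sets\<close>.\<close>
  define L where "L b = (if b then K else {(n, j)})" for b
  have "indep_sets (\<lambda>b. sigma_sets (space M) (\<Union>i\<in>L b. E i)) UNIV"
  proof (rule indep_sets_collect_sigma)
    show "indep_sets E (\<Union>b\<in>UNIV. L b)"
      by (rule indep_sets_mono_index[OF _ indE]) (use K i in \<open>auto simp: L_def split: if_splits\<close>)
    show "disjoint_family_on L UNIV" using i by (auto simp: L_def disjoint_family_on_def)
    show "Int_stable (E i)" for i
    proof -
      obtain n j where i: "i = (n, j)" by (cases i)
      show ?thesis
      proof (rule Int_stableI)
        fix a b assume "a \<in> E i" "b \<in> E i"
        then obtain A B where "a = U n j -` A \<inter> space M" "b = U n j -` B \<inter> space M"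
          and AB: "A \<in> sets borel" "B \<in> sets borel" by (auto simp: E_def i)
        then have "a \<inter> b = U n j -` (A \<inter> B) \<inter> space M" by auto
        moreover have "U n j -` (A \<inter> B) \<inter> space M \<in> E i" using sets.Int[OF AB] unfolding E_def i by blast
        ultimately show "a \<inter> b \<in> E i" by simp
      qed
    qed
  qed
  moreover have "(\<lambda>b. sigma_sets (space M) (\<Union>i\<in>L b. E i)) = case_bool (S K) (S {(n, j)})"
    by (auto simp: fun_eq_iff L_def S split: bool.splits)
  ultimately have SS: "indep_set (S K) (S {(n, j)})" by (simp add: indep_set_def)
  have mono: "S L \<subseteq> S ?I" if "L \<subseteq> ?I" for L
    unfolding S using that by (intro sigma_sets_mono' UN_mono) auto
  interpret I: sigma_algebra "space M" "S ?I" unfolding S by (rule sigma_algebra_sigma_sets[OF SPow])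
  \<comment> \<open>The four families are, in order, the events of \<open>Th 0\<close>, of the
    samples in \<open>K\<close>, of the sample \<open>(n, j)\<close>, and of all samples.\<close>
  have "indep_set (sigma_sets (space M) (gen_sigma M {0} Th \<union> S K)) (sigma_sets (space M) (S {(n, j)}))"
  proof (rule indep_set_Un_sigma)
    show "indep_set (gen_sigma M {0} Th) (S ?I)" using Th0_indep by (simp add: S_def)
    show "space M \<in> gen_sigma M {0} Th" "space M \<in> S K"
      unfolding gen_sigma_def S by (auto intro: sigma_sets_top)
    show "b \<inter> d \<in> S ?I" if "b \<in> S K" "d \<in> S {(n, j)}" for b d
    proof (rule I.Int)
      show "b \<in> S ?I" using that mono[OF K] by blast
      show "d \<in> S ?I" using that mono[of "{(n, j)}"] i by blast
    qed
  qed (use SS mono[OF K] Int_stable_gen_sigma in \<open>simp_all add: S_def\<close>)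
  moreover have "sigma_sets (space M) (S {(n, j)}) = sigma_sets (space M) {U n j -` A \<inter> space M | A. A \<in> sets borel}"
    unfolding S using sigma_sets_sigma_sets_eq[OF SPow[of "{(n, j)}"]] by (simp add: E_def)
  ultimately show ?thesis by (simp add: sets_past S_def)
qed

lemma past_measurable:
  assumes K: "K \<subseteq> UNIV \<times> {1..J}" and X: "X \<in> past K \<rightarrow>\<^sub>M S"
  shows "X \<in> M \<rightarrow>\<^sub>M S"
proof -
  have "gen_sigma M {0} Th \<union> gen_sigma M K (\<lambda>(n, j). U n j) \<subseteq> sets M"
    unfolding gen_sigma_def using K U_meas Th0_meas
    by (intro Un_least sets.sigma_sets_subset) (auto intro!: measurable_sets)
  then have "sets (past K) \<subseteq> sets M" unfolding sets_past by (rule sets.sigma_sets_subset)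
  then show ?thesis
    using X measurable_mono[of S S "past K" M] by (auto simp: space_past)
qed

lemma distr_Pair_past:
  assumes K: "K \<subseteq> UNIV \<times> {1..J}" and i: "j \<in> {1..J}" "(n, j) \<notin> K" and X: "X \<in> past K \<rightarrow>\<^sub>M S"
  shows "distr M (S \<Otimes>\<^sub>M borel) (\<lambda>\<omega>. (X \<omega>, U n j \<omega>)) = distr M S X \<Otimes>\<^sub>M distr M borel (U n j)"
proof (rule distr_Pair_indep_set[OF past_measurable[OF K X] U_meas[OF i(1)] indep_set_past[OF K i]])
  show "X -` a \<inter> space M \<in> sets (past K)" if "a \<in> sets S" for a
    using measurable_sets[OF X that] by (simp add: space_past)
qed auto

text \<open>The past pair \<open>(W, X)\<close> is frozen and the fresh sample averaged out, which
  turns the stochastic gradient into its mean.\<close>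

lemma inner_G_expectation:
  assumes K: "K \<subseteq> UNIV \<times> {1..J}" and i: "j \<in> {1..J}" "(n, j) \<notin> K"
    and W: "W \<in> past K \<rightarrow>\<^sub>M borel" and X: "X \<in> past K \<rightarrow>\<^sub>M borel"
    and sq: "sq_integrable M W" "sq_integrable M (\<lambda>\<omega>. G (X \<omega>) (U n j \<omega>))"
  shows "(\<integral>\<omega>. W \<omega> \<bullet> G (X \<omega>) (U n j \<omega>) \<partial>M) = (\<integral>\<omega>. W \<omega> \<bullet> g (X \<omega>) \<partial>M)"
proof -
  let ?f = "\<lambda>p. fst (fst p) \<bullet> G (snd (fst p)) (snd p)"
  note [measurable] = past_measurable[OF K W] past_measurable[OF K X] i(1)
  have "(\<integral>\<omega>. ?f ((W \<omega>, X \<omega>), U n j \<omega>) \<partial>M)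
      = (\<integral>\<omega>. (\<integral>u. ?f ((W \<omega>, X \<omega>), u) \<partial>distr M borel (U n j)) \<partial>M)"
  proof (rule expectation_product_law[where S = "borel \<Otimes>\<^sub>M borel"])
    show "distr M ((borel \<Otimes>\<^sub>M borel) \<Otimes>\<^sub>M borel) (\<lambda>\<omega>. ((W \<omega>, X \<omega>), U n j \<omega>))
        = distr M (borel \<Otimes>\<^sub>M borel) (\<lambda>\<omega>. (W \<omega>, X \<omega>)) \<Otimes>\<^sub>M distr M borel (U n j)"
      by (rule distr_Pair_past[OF K i]) (use W X in simp)
    show "(\<lambda>\<omega>. (W \<omega>, X \<omega>)) \<in> M \<rightarrow>\<^sub>M borel \<Otimes>\<^sub>M borel" "U n j \<in> M \<rightarrow>\<^sub>M borel" by measurable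
    show "?f \<in> borel_measurable ((borel \<Otimes>\<^sub>M borel) \<Otimes>\<^sub>M borel)" by measurable
    show "integrable M (\<lambda>\<omega>. ?f ((W \<omega>, X \<omega>), U n j \<omega>))"
      using integrable_inner_sq_integrable[OF sq] by simp
  qed
  \<comment> \<open>\<open>integrable_G\<close> lets the integral over the sample pass inside the
    inner product.\<close>
  then show ?thesis using i by (simp add: distr_U g_def integrable_G)
qed

text \<open>Any sample outside the past of \<open>Th n\<close> has the same joint law with
  \<open>Th n\<close> as \<open>U 0 1\<close> has, so the moment bounds assumed for
  \<open>U 0 1\<close> carry over.\<close>

lemma G_fresh:
  assumes i: "j \<in> {1..J}" "(k, j) \<notin> {1..n} \<times> {1..J}"
  shows "sq_integrable M (\<lambda>\<omega>. G (Th n \<omega>) (U k j \<omega>))"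
    and "(\<integral>\<omega>. (norm (G (Th n \<omega>) (U k j \<omega>)))\<^sup>2 \<partial>M) \<le> cc\<^sup>2"
proof -
  let ?f = "\<lambda>(x, u). (norm (G x u))\<^sup>2"
  have K: "{1..n} \<times> {1..J} \<subseteq> UNIV \<times> {1..J}" by auto
  note [measurable] = past_measurable[OF K Th_m_past(1)] i(1)
  have J1: "1 \<in> {1..J}" using J by auto
  have "distr M (borel \<Otimes>\<^sub>M borel) (\<lambda>\<omega>. (Th n \<omega>, U k' j' \<omega>)) = distr M borel (Th n) \<Otimes>\<^sub>M law"
    if "j' \<in> {1..J}" "(k', j') \<notin> {1..n} \<times> {1..J}" for k' j'
    using distr_Pair_past[OF K that Th_m_past(1)] distr_U[OF that(1)] by simp
  from this[OF i] this[OF J1, of 0]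
  have eq: "distr M (borel \<Otimes>\<^sub>M borel) (\<lambda>\<omega>. (Th n \<omega>, U k j \<omega>))
      = distr M (borel \<Otimes>\<^sub>M borel) (\<lambda>\<omega>. (Th n \<omega>, U 0 1 \<omega>))" by simp
  have f: "?f \<in> borel_measurable (borel \<Otimes>\<^sub>M borel)" by measurable
  have p: "(\<lambda>\<omega>. (Th n \<omega>, U k j \<omega>)) \<in> M \<rightarrow>\<^sub>M borel \<Otimes>\<^sub>M borel"
    "(\<lambda>\<omega>. (Th n \<omega>, U 0 1 \<omega>)) \<in> M \<rightarrow>\<^sub>M borel \<Otimes>\<^sub>M borel"
    using J1 by auto
  show "sq_integrable M (\<lambda>\<omega>. G (Th n \<omega>) (U k j \<omega>))"
    unfolding sq_integrable_def
    using cc_sq[of n] integrable_distr_eq[OF p(1) f] integrable_distr_eq[OF p(2) f] eq by auto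
  have "(\<integral>\<omega>. (norm (G (Th n \<omega>) (U k j \<omega>)))\<^sup>2 \<partial>M) = (\<integral>\<omega>. (norm (G (Th n \<omega>) (U 0 1 \<omega>)))\<^sup>2 \<partial>M)"
    using integral_distr[OF p(1) f] integral_distr[OF p(2) f] eq by auto
  also have "\<dots> = (sqrt (\<integral>\<omega>. (norm (G (Th n \<omega>) (U 0 1 \<omega>)))\<^sup>2 \<partial>M))\<^sup>2" by simp
  also have "\<dots> \<le> cc\<^sup>2" using cc_bound by (intro power_mono) auto
  finally show "(\<integral>\<omega>. (norm (G (Th n \<omega>) (U k j \<omega>)))\<^sup>2 \<partial>M) \<le> cc\<^sup>2" .
qed

text \<open>Indexed by the point of evaluation: the samples are those of step \<open>Suc n\<close>,
  so \<open>batch n\<close> enters \<open>m (Suc n)\<close>.\<close>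

definition batch :: "nat \<Rightarrow> 'w \<Rightarrow> real ^ 'd" where
  "batch n \<omega> = (1 / real J) *\<^sub>R (\<Sum>j = 1..J. G (Th n \<omega>) (U (Suc n) j \<omega>))"

lemma m_Suc: "\<omega> \<in> space M \<Longrightarrow> m (Suc n) \<omega> = \<alpha> *\<^sub>R m n \<omega> + (1 - \<alpha>) *\<^sub>R batch n \<omega>"
  by (simp add: m_rec batch_def)

lemma sq_integrable_batch: "sq_integrable M (batch n)"
  unfolding batch_def by (intro sq_integrable_scaleR sq_integrable_sum G_fresh) auto

lemma sq_integrable_Th_m: "sq_integrable M (Th n)" "sq_integrable M (m n)"
proof (induction n)
  case 0
  show "sq_integrable M (Th 0)" using Th0_meas Th0_sq by (simp add: sq_integrable_def)
  have "sq_integrable M (\<lambda>_. \<nu>)" by (simp add: sq_integrable_def)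
  then show "sq_integrable M (m 0)" by (rule sq_integrable_cong) (simp add: m_0)
next
  case (Suc n)
  have "sq_integrable M (\<lambda>\<omega>. \<alpha> *\<^sub>R m n \<omega> + (1 - \<alpha>) *\<^sub>R batch n \<omega>)"
    by (intro sq_integrable_add sq_integrable_scaleR Suc sq_integrable_batch)
  then show m: "sq_integrable M (m (Suc n))"
    by (rule sq_integrable_cong) (simp add: m_Suc)
  have "sq_integrable M (\<lambda>\<omega>. Th n \<omega> + \<gamma> (Suc n) *\<^sub>R m (Suc n) \<omega>)"
    by (intro sq_integrable_add sq_integrable_scaleR Suc m)
  then show "sq_integrable M (Th (Suc n))" by (rule sq_integrable_cong) (simp add: Th_rec)
qed

lemma sq_integrable_diff_const: "sq_integrable M (\<lambda>\<omega>. Th n \<omega> - vartheta)"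
proof -
  have "sq_integrable M (\<lambda>_. - vartheta)" by (simp add: sq_integrable_def)
  from sq_integrable_add[OF sq_integrable_Th_m(1) this] show ?thesis by simp
qed

lemma sq_integrable_g: "sq_integrable M (\<lambda>\<omega>. g (Th n \<omega>))"
proof (rule sq_integrable_bound)
  show "integrable M (\<lambda>\<omega>. (norm (Th n \<omega> - vartheta))\<^sup>2 / c\<^sup>2)"
    using sq_integrable_diff_const[of n] by (simp add: sq_integrable_def)
  have [measurable]: "Th n \<in> borel_measurable M" using sq_integrable_Th_m by (simp add: sq_integrable_def)
  show "(\<lambda>\<omega>. g (Th n \<omega>)) \<in> borel_measurable M" by measurable
  show "(norm (g (Th n \<omega>)))\<^sup>2 \<le> (norm (Th n \<omega> - vartheta))\<^sup>2 / c\<^sup>2" for \<omega>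
    using power_mono[OF norm_g_le[of "Th n \<omega>"], of 2] c_pos by (simp add: field_simps)
qed

text \<open>A mini-batch is unbiased given the past, since each of its samples is fresh.\<close>

lemma inner_batch:
  assumes "W \<in> past ({1..n} \<times> {1..J}) \<rightarrow>\<^sub>M borel" "sq_integrable M W"
  shows "(\<integral>\<omega>. W \<omega> \<bullet> batch n \<omega> \<partial>M) = (\<integral>\<omega>. W \<omega> \<bullet> g (Th n \<omega>) \<partial>M)"
proof -
  have "(\<integral>\<omega>. W \<omega> \<bullet> batch n \<omega> \<partial>M) = (1 / real J) * (\<Sum>j = 1..J. \<integral>\<omega>. W \<omega> \<bullet> G (Th n \<omega>) (U (Suc n) j \<omega>) \<partial>M)"
    unfolding batch_def inner_scaleR_right inner_sum_right integral_mult_right_zero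
    by (subst Bochner_Integration.integral_sum)
       (auto intro!: integrable_inner_sq_integrable G_fresh assms)
  also have "\<dots> = (1 / real J) * (\<Sum>j = 1..J. \<integral>\<omega>. W \<omega> \<bullet> g (Th n \<omega>) \<partial>M)"
    by (intro arg_cong2[where f = "(*)"] refl sum.cong inner_G_expectation[where K = "{1..n} \<times> {1..J}"])
       (auto intro: assms Th_m_past G_fresh simp del: One_nat_def)
  finally show ?thesis using J by simp
qed

text \<open>Of the J^2 pairs of samples, the J diagonal ones contribute at most
  \<open>cc\<^sup>2\<close> each and all others exactly the second moment of the mean gradient. This
  produces the gain 1 / J in the noise.\<close>

lemma batch_second_moment:
  "(\<integral>\<omega>. (norm (batch n \<omega>))\<^sup>2 \<partial>M)
    \<le> cc\<^sup>2 / real J + (real J - 1) / real J * (\<integral>\<omega>. (norm (g (Th n \<omega>)))\<^sup>2 \<partial>M)"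
proof -
  define r where "r = (\<integral>\<omega>. (norm (g (Th n \<omega>)))\<^sup>2 \<partial>M)"
  define Y where "Y j \<omega> = G (Th n \<omega>) (U (Suc n) j \<omega>)" for j \<omega>
  have Y: "sq_integrable M (Y j)" "(\<integral>\<omega>. (norm (Y j \<omega>))\<^sup>2 \<partial>M) \<le> cc\<^sup>2" if "j \<in> {1..J}" for j
    unfolding Y_def using that by (auto intro!: G_fresh)
  \<comment> \<open>Average over the sample \<open>j\<close> with the sample \<open>i\<close> known, then over the sample \<open>i\<close>.\<close>
  have cross: "(\<integral>\<omega>. Y i \<omega> \<bullet> Y j \<omega> \<partial>M) = r" if ij: "i \<in> {1..J}" "j \<in> {1..J}" "i \<noteq> j" for i j
  proof -
    let ?K = "{1..n} \<times> {1..J}" and ?L = "insert (Suc n, i) ({1..n} \<times> {1..J})"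
    have [measurable]: "Th n \<in> past ?L \<rightarrow>\<^sub>M borel" "U (Suc n) i \<in> past ?L \<rightarrow>\<^sub>M borel" "Th n \<in> past ?K \<rightarrow>\<^sub>M borel"
      by (auto intro: past_mono[OF Th_m_past(1)] U_past Th_m_past)
    have "(\<integral>\<omega>. Y i \<omega> \<bullet> Y j \<omega> \<partial>M) = (\<integral>\<omega>. Y i \<omega> \<bullet> g (Th n \<omega>) \<partial>M)"
      unfolding Y_def
      by (rule inner_G_expectation[where K = ?L]) (use ij in \<open>auto intro: G_fresh simp del: One_nat_def\<close>)
    also have "\<dots> = (\<integral>\<omega>. g (Th n \<omega>) \<bullet> Y i \<omega> \<partial>M)" by (simp add: inner_commute)
    also have "\<dots> = (\<integral>\<omega>. g (Th n \<omega>) \<bullet> g (Th n \<omega>) \<partial>M)"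
      unfolding Y_def
      by (rule inner_G_expectation[where K = ?K]) (use ij in \<open>auto intro: G_fresh sq_integrable_g simp del: One_nat_def\<close>)
    finally show ?thesis by (simp add: r_def power2_norm_eq_inner)
  qed
  have "(\<integral>\<omega>. (norm (batch n \<omega>))\<^sup>2 \<partial>M)
      = (\<integral>\<omega>. (1 / (real J)\<^sup>2) * (\<Sum>i = 1..J. \<Sum>j = 1..J. Y i \<omega> \<bullet> Y j \<omega>) \<partial>M)"
  proof (intro Bochner_Integration.integral_cong refl)
    fix \<omega>
    have "(norm (batch n \<omega>))\<^sup>2 = (1 / (real J)\<^sup>2) * (norm (\<Sum>i = 1..J. Y i \<omega>))\<^sup>2"
      by (simp add: batch_def Y_def power_divide)
    then show "(norm (batch n \<omega>))\<^sup>2 = (1 / (real J)\<^sup>2) * (\<Sum>i = 1..J. \<Sum>j = 1..J. Y i \<omega> \<bullet> Y j \<omega>)"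
      by (simp only: power2_norm_eq_inner inner_sum_left inner_sum_right inner_commute)
  qed
  also have "\<dots> = (1 / (real J)\<^sup>2) * (\<Sum>i = 1..J. \<Sum>j = 1..J. \<integral>\<omega>. Y i \<omega> \<bullet> Y j \<omega> \<partial>M)"
  proof -
    have int: "integrable M (\<lambda>\<omega>. Y i \<omega> \<bullet> Y j \<omega>)" if "i \<in> {1..J}" "j \<in> {1..J}" for i j
      using that by (intro integrable_inner_sq_integrable Y)
    have "(\<integral>\<omega>. (\<Sum>i = 1..J. \<Sum>j = 1..J. Y i \<omega> \<bullet> Y j \<omega>) \<partial>M) = (\<Sum>i = 1..J. \<integral>\<omega>. (\<Sum>j = 1..J. Y i \<omega> \<bullet> Y j \<omega>) \<partial>M)"
      by (intro Bochner_Integration.integral_sum Bochner_Integration.integrable_sum int)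
    also have "\<dots> = (\<Sum>i = 1..J. \<Sum>j = 1..J. \<integral>\<omega>. Y i \<omega> \<bullet> Y j \<omega> \<partial>M)"
      by (intro sum.cong refl Bochner_Integration.integral_sum int)
    finally show ?thesis by simp
  qed
  \<comment> \<open>The diagonal is written as a correction to the constant \<open>r\<close>, so
    that the double sum has a closed form.\<close>
  also have "\<dots> \<le> (1 / (real J)\<^sup>2) * (\<Sum>i = 1..J. \<Sum>j = 1..J. r + (if j = i then cc\<^sup>2 - r else 0))"
    using Y cross by (intro mult_left_mono sum_mono) (auto simp: power2_norm_eq_inner)
  also have "(\<Sum>i = 1..J. \<Sum>j = 1..J. r + (if j = i then cc\<^sup>2 - r else 0)) = real J * (real J * r + (cc\<^sup>2 - r))"
    by (simp add: sum.distrib algebra_simps)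
  also have "(1 / (real J)\<^sup>2) * \<dots> = cc\<^sup>2 / real J + (real J - 1) / real J * r"
    using J by (simp add: field_simps power2_eq_square)
  finally show ?thesis by (simp add: r_def)
qed

section \<open>Recursions for the moments\<close>

definition err :: "nat \<Rightarrow> real" where "err n = (\<integral>\<omega>. (norm (Th n \<omega> - vartheta))\<^sup>2 \<partial>M)"
definition cross :: "nat \<Rightarrow> real" where "cross n = (\<integral>\<omega>. (Th n \<omega> - vartheta) \<bullet> m n \<omega> \<partial>M)"
definition mom :: "nat \<Rightarrow> real" where "mom n = (\<integral>\<omega>. (norm (m n \<omega>))\<^sup>2 \<partial>M)"
definition drift :: "nat \<Rightarrow> real" where "drift n = (\<integral>\<omega>. (Th n \<omega> - vartheta) \<bullet> g (Th n \<omega>) \<partial>M)"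
definition grad :: "nat \<Rightarrow> real" where "grad n = (\<integral>\<omega>. (norm (g (Th n \<omega>)))\<^sup>2 \<partial>M)"

lemma err_mom_grad_nonneg: "0 \<le> err n" "0 \<le> mom n" "0 \<le> grad n"
  by (auto simp: err_def mom_def grad_def)

lemma drift_le: "drift n \<le> - c * err n"
proof -
  have "drift n \<le> (\<integral>\<omega>. - c * (norm (Th n \<omega> - vartheta))\<^sup>2 \<partial>M)"
    unfolding drift_def
    using sq_integrable_diff_const[of n] integrable_inner_sq_integrable[OF sq_integrable_diff_const sq_integrable_g]
    by (intro integral_mono inner_g_le) (auto simp: sq_integrable_def)
  then show ?thesis by (simp add: err_def)
qed

lemma grad_le: "c\<^sup>2 * grad n \<le> err n"
proof -
  have "(\<integral>\<omega>. c\<^sup>2 * (norm (g (Th n \<omega>)))\<^sup>2 \<partial>M) \<le> err n"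
    unfolding err_def
  proof (rule integral_mono)
    show "c\<^sup>2 * (norm (g (Th n \<omega>)))\<^sup>2 \<le> (norm (Th n \<omega> - vartheta))\<^sup>2" for \<omega>
      using power_mono[OF norm_g_le[of "Th n \<omega>"], of 2] c_pos by (simp add: power_mult_distrib)
  qed (use sq_integrable_diff_const[of n] sq_integrable_g[of n] in \<open>auto simp: sq_integrable_def\<close>)
  then show ?thesis by (simp add: grad_def)
qed

text \<open>A past \<open>W\<close> sees only the mean of the new gradient, which closes the
  recursion for the first-order pairings.\<close>

lemma inner_m_Suc:
  assumes "W \<in> past ({1..n} \<times> {1..J}) \<rightarrow>\<^sub>M borel" "sq_integrable M W"
  shows "(\<integral>\<omega>. W \<omega> \<bullet> m (Suc n) \<omega> \<partial>M)
    = \<alpha> * (\<integral>\<omega>. W \<omega> \<bullet> m n \<omega> \<partial>M) + (1 - \<alpha>) * (\<integral>\<omega>. W \<omega> \<bullet> g (Th n \<omega>) \<partial>M)"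
proof -
  have "(\<integral>\<omega>. W \<omega> \<bullet> m (Suc n) \<omega> \<partial>M)
      = (\<integral>\<omega>. \<alpha> * (W \<omega> \<bullet> m n \<omega>) + (1 - \<alpha>) * (W \<omega> \<bullet> batch n \<omega>) \<partial>M)"
    by (intro Bochner_Integration.integral_cong refl) (simp add: m_Suc inner_add_right)
  also have "\<dots> = \<alpha> * (\<integral>\<omega>. W \<omega> \<bullet> m n \<omega> \<partial>M) + (1 - \<alpha>) * (\<integral>\<omega>. W \<omega> \<bullet> batch n \<omega> \<partial>M)"
    by (simp add: integrable_inner_sq_integrable assms sq_integrable_Th_m sq_integrable_batch)
  finally show ?thesis by (simp add: inner_batch[OF assms])
qed

lemma inner_diff_m_Suc:
  "(\<integral>\<omega>. (Th n \<omega> - vartheta) \<bullet> m (Suc n) \<omega> \<partial>M) = \<alpha> * cross n + (1 - \<alpha>) * drift n"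
  unfolding cross_def drift_def using Th_m_past(1)[of n]
  by (intro inner_m_Suc sq_integrable_diff_const) auto

lemma err_Suc: "err (Suc n)
    = err n + 2 * \<gamma> (Suc n) * (\<alpha> * cross n + (1 - \<alpha>) * drift n) + (\<gamma> (Suc n))\<^sup>2 * mom (Suc n)"
proof -
  note sq = sq_integrable_diff_const[of n] sq_integrable_Th_m(2)[of "Suc n"]
  have "err (Suc n) = (\<integral>\<omega>. (norm (Th n \<omega> - vartheta))\<^sup>2
      + 2 * \<gamma> (Suc n) * ((Th n \<omega> - vartheta) \<bullet> m (Suc n) \<omega>) + (\<gamma> (Suc n))\<^sup>2 * (norm (m (Suc n) \<omega>))\<^sup>2 \<partial>M)"
    unfolding err_def
  proof (intro Bochner_Integration.integral_cong refl)
    fix \<omega> assume "\<omega> \<in> space M"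
    then have *: "Th (Suc n) \<omega> - vartheta = 1 *\<^sub>R (Th n \<omega> - vartheta) + \<gamma> (Suc n) *\<^sub>R m (Suc n) \<omega>"
      by (simp add: Th_rec)
    show "(norm (Th (Suc n) \<omega> - vartheta))\<^sup>2 = (norm (Th n \<omega> - vartheta))\<^sup>2
      + 2 * \<gamma> (Suc n) * ((Th n \<omega> - vartheta) \<bullet> m (Suc n) \<omega>) + (\<gamma> (Suc n))\<^sup>2 * (norm (m (Suc n) \<omega>))\<^sup>2"
      by (simp only: * norm_lincomb_sq) simp
  qed
  also have "\<dots> = err n + 2 * \<gamma> (Suc n) * (\<integral>\<omega>. (Th n \<omega> - vartheta) \<bullet> m (Suc n) \<omega> \<partial>M) + (\<gamma> (Suc n))\<^sup>2 * mom (Suc n)"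
    using sq integrable_inner_sq_integrable[OF sq] by (simp add: sq_integrable_def err_def mom_def)
  finally show ?thesis by (simp add: inner_diff_m_Suc)
qed

text \<open>Replacing \<open>Th n\<close> by \<open>Th (Suc n)\<close> in the first slot adds the
  increment \<open>\<gamma> (Suc n) *\<^sub>R m (Suc n)\<close>, hence a multiple of the squared
  norm of the new momentum.\<close>

lemma cross_Suc: "cross (Suc n) = \<alpha> * cross n + (1 - \<alpha>) * drift n + \<gamma> (Suc n) * mom (Suc n)"
proof -
  note sq = sq_integrable_diff_const[of n] sq_integrable_Th_m(2)[of "Suc n"]
  have "cross (Suc n) = (\<integral>\<omega>. (Th n \<omega> - vartheta) \<bullet> m (Suc n) \<omega> + \<gamma> (Suc n) * (norm (m (Suc n) \<omega>))\<^sup>2 \<partial>M)"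
    unfolding cross_def
    by (intro Bochner_Integration.integral_cong refl)
       (simp add: Th_rec power2_norm_eq_inner inner_add_left inner_diff_left)
  also have "\<dots> = (\<integral>\<omega>. (Th n \<omega> - vartheta) \<bullet> m (Suc n) \<omega> \<partial>M) + \<gamma> (Suc n) * mom (Suc n)"
    using sq integrable_inner_sq_integrable[OF sq] by (simp add: sq_integrable_def mom_def)
  finally show ?thesis by (simp add: inner_diff_m_Suc)
qed

lemma mom_Suc_le:
  assumes \<alpha>: "0 \<le> \<alpha>" "\<alpha> < 1"
  shows "mom (Suc n) \<le> \<alpha> * mom n + (1 - \<alpha>) * ((real J - 1 + \<alpha>) / real J) * grad n + (1 - \<alpha>)\<^sup>2 * (cc\<^sup>2 / real J)"
proof -
  note sq = sq_integrable_Th_m(2)[of n] sq_integrable_g[of n] sq_integrable_batch[of n]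
  have "mom (Suc n) = (\<integral>\<omega>. \<alpha>\<^sup>2 * (norm (m n \<omega>))\<^sup>2 + 2 * \<alpha> * (1 - \<alpha>) * (m n \<omega> \<bullet> batch n \<omega>)
      + (1 - \<alpha>)\<^sup>2 * (norm (batch n \<omega>))\<^sup>2 \<partial>M)"
    unfolding mom_def
    by (intro Bochner_Integration.integral_cong refl)
       (simp add: m_Suc norm_lincomb_sq)
  also have "\<dots> = \<alpha>\<^sup>2 * mom n + 2 * \<alpha> * (1 - \<alpha>) * (\<integral>\<omega>. m n \<omega> \<bullet> batch n \<omega> \<partial>M)
      + (1 - \<alpha>)\<^sup>2 * (\<integral>\<omega>. (norm (batch n \<omega>))\<^sup>2 \<partial>M)"
    using sq integrable_inner_sq_integrable[OF sq(1) sq(3)] by (simp add: sq_integrable_def mom_def)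
  also have "\<dots> \<le> \<alpha>\<^sup>2 * mom n + \<alpha> * (1 - \<alpha>) * (mom n + grad n)
      + (1 - \<alpha>)\<^sup>2 * (cc\<^sup>2 / real J + (real J - 1) / real J * grad n)"
  proof -
    \<comment> \<open>Averaging the batch before using 2 xy \<le> x^2 + y^2 brings in
      \<open>grad n\<close> and thus keeps the sampling variance out of the mixed term.\<close>
    have "2 * (\<integral>\<omega>. m n \<omega> \<bullet> batch n \<omega> \<partial>M) = (\<integral>\<omega>. 2 * (m n \<omega> \<bullet> g (Th n \<omega>)) \<partial>M)"
      by (simp add: inner_batch[OF Th_m_past(2) sq(1)])
    also have "\<dots> \<le> (\<integral>\<omega>. (norm (m n \<omega>))\<^sup>2 + (norm (g (Th n \<omega>)))\<^sup>2 \<partial>M)"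
    proof (rule integral_mono)
      show "2 * (m n \<omega> \<bullet> g (Th n \<omega>)) \<le> (norm (m n \<omega>))\<^sup>2 + (norm (g (Th n \<omega>)))\<^sup>2" for \<omega>
        using norm_cauchy_schwarz[of "m n \<omega>" "g (Th n \<omega>)"]
          sum_squares_bound[of "norm (m n \<omega>)" "norm (g (Th n \<omega>))"] by linarith
    qed (use sq integrable_inner_sq_integrable[OF sq(1,2)] in \<open>auto simp: sq_integrable_def\<close>)
    also have "\<dots> = mom n + grad n" using sq by (simp add: sq_integrable_def mom_def grad_def)
    finally have "\<alpha> * (1 - \<alpha>) * (2 * (\<integral>\<omega>. m n \<omega> \<bullet> batch n \<omega> \<partial>M)) \<le> \<alpha> * (1 - \<alpha>) * (mom n + grad n)"
      using \<alpha> by (intro mult_left_mono) auto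
    moreover have "(1 - \<alpha>)\<^sup>2 * (\<integral>\<omega>. (norm (batch n \<omega>))\<^sup>2 \<partial>M)
        \<le> (1 - \<alpha>)\<^sup>2 * (cc\<^sup>2 / real J + (real J - 1) / real J * grad n)"
      using batch_second_moment[of n] by (intro mult_left_mono) (auto simp: grad_def)
    ultimately show ?thesis by simp
  qed
  \<comment> \<open>Coefficients: \<alpha>^2 + \<alpha> (1 - \<alpha>) = \<alpha> and \<alpha> + (1
    - \<alpha>) (J - 1) / J = (J - 1 + \<alpha>) / J.\<close>
  also have "\<dots> = \<alpha> * mom n + (1 - \<alpha>) * ((real J - 1 + \<alpha>) / real J) * grad n + (1 - \<alpha>)\<^sup>2 * (cc\<^sup>2 / real J)"
    using J by (simp add: field_simps power2_eq_square)
  finally show ?thesis .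
qed

end

subsection \<open>The convergence rate\<close>

text \<open>The conclusion asserts integrability as well, because a Bochner integral without it
  would be 0 and the bound would say nothing. Likewise \<open>cc_sq\<close> and
  \<open>cc_bound\<close> together express the finite supremum.\<close>

theorem theorem3p2:
  fixes M :: "'w measure"
    and J :: nat
    and U :: "nat \<Rightarrow> nat \<Rightarrow> 'w \<Rightarrow> real ^ 'e"
    and G :: "real ^ 'd \<Rightarrow> real ^ 'e \<Rightarrow> real ^ 'd"
    and \<alpha> :: real
    and \<nu> :: "real ^ 'd"
    and \<gamma> :: "nat \<Rightarrow> real"
    and Th m :: "nat \<Rightarrow> 'w \<Rightarrow> real ^ 'd"
    and F :: "nat \<Rightarrow> 'w set set"
    and cc c :: real
    and vartheta :: "real ^ 'd"
    and lam \<Gamma> :: real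
    and N :: nat
    and V :: "nat \<Rightarrow> real"
  assumes prob: "prob_space M"
    and J: "J \<ge> 1"
    and U_indep: "prob_space.indep_vars M (\<lambda>_. borel) (\<lambda>(n, j). U n j) (UNIV \<times> {1..J})"
    and U_ident: "\<And>n j. j \<in> {1..J} \<Longrightarrow> distr M borel (U n j) = distr M borel (U 0 1)"
    and G_meas: "(\<lambda>(\<theta>, u). G \<theta> u) \<in> borel_measurable (borel \<Otimes>\<^sub>M borel)"
    and G_int: "\<And>\<theta>. integrable M (\<lambda>\<omega>. norm (G \<theta> (U 0 1 \<omega>)))"
    and \<alpha>: "0 \<le> \<alpha>" "\<alpha> < 1"
    and \<gamma>_pos: "\<And>n. \<gamma> n > 0"
    and Th_meas: "\<And>n. Th n \<in> borel_measurable M"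
    and m_meas: "\<And>n. m n \<in> borel_measurable M"
    and m_0: "\<And>\<omega>. \<omega> \<in> space M \<Longrightarrow> m 0 \<omega> = \<nu>"
    and Th_rec: "\<And>n \<omega>. n \<ge> 1 \<Longrightarrow> \<omega> \<in> space M \<Longrightarrow>
          Th n \<omega> = Th (n - 1) \<omega> + \<gamma> n *\<^sub>R m n \<omega>"
    and m_rec: "\<And>n \<omega>. n \<ge> 1 \<Longrightarrow> \<omega> \<in> space M \<Longrightarrow>
          m n \<omega> = \<alpha> *\<^sub>R m (n - 1) \<omega>
            + (1 - \<alpha>) *\<^sub>R ((1 / real J) *\<^sub>R (\<Sum>j = 1..J. G (Th (n - 1) \<omega>) (U n j \<omega>)))"
    and Th0_indep: "prob_space.indep_set M
          (gen_sigma M {0} Th) (gen_sigma M (UNIV \<times> {1..J}) (\<lambda>(n, j). U n j))"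
    and Th0_sq: "integrable M (\<lambda>\<omega>. (norm (Th 0 \<omega>))\<^sup>2)"
    and F_def: "\<And>n. F n = gen_sigma M {0..n} Th"
    and U_hist: "\<And>n j. n \<ge> 1 \<Longrightarrow> j \<in> {1..J} \<Longrightarrow>
          prob_space.indep_set M (gen_sigma M {j} (U n)) (F (n - 1))"
    and cc_nonneg: "cc \<ge> 0"
    and cc_sq: "\<And>n. integrable M (\<lambda>\<omega>. (norm (G (Th n \<omega>) (U 0 1 \<omega>)))\<^sup>2)"
    and cc_bound: "\<And>n. sqrt (\<integral>\<omega>. (norm (G (Th n \<omega>) (U 0 1 \<omega>)))\<^sup>2 \<partial>M) \<le> cc"
    and c_pos: "c > 0"
    and c_coercive: "\<And>\<theta>. (\<theta> - vartheta) \<bullet> (\<integral>\<omega>. G \<theta> (U 1 1 \<omega>) \<partial>M)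
          \<le> - c * max ((norm (\<theta> - vartheta))\<^sup>2) ((norm (\<integral>\<omega>. G \<theta> (U 1 1 \<omega>) \<partial>M))\<^sup>2)"
    and lam: "0 < lam" "lam < 1"
    and \<Gamma>_pos: "\<Gamma> > 0"
    and \<gamma>_eq: "\<And>n. n \<ge> 1 \<Longrightarrow> \<gamma> n = \<Gamma> * real n powr (- lam)"
    and N_def: "N = nat \<lceil>Max {2,
            (2 * (1 + \<alpha>) * c * \<Gamma> / (1 - \<alpha>)) powr (1 / lam),
            (4 * lam / ((1 - \<alpha>) * c * \<Gamma>)) powr (1 / (1 - lam)),
            (2 * (2 - \<alpha>) * (real J - 1 + \<alpha>) * \<Gamma> / ((1 - \<alpha>)\<^sup>2 * c ^ 3 * real J)) powr (1 / lam)}\<rceil>"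
    and V_nonneg: "\<And>n. V n \<ge> 0"
    and V_eq: "\<And>n. V n = (\<integral>\<omega>. (norm (Th n \<omega> - vartheta))\<^sup>2 \<partial>M)
            + (1 + \<alpha>) / (1 - \<alpha>) * \<gamma> n * max (\<integral>\<omega>. (Th n \<omega> - vartheta) \<bullet> m n \<omega> \<partial>M) 0
            + 2 / (1 - \<alpha>)\<^sup>2 * (\<gamma> n)\<^sup>2 * (\<integral>\<omega>. (norm (m n \<omega>))\<^sup>2 \<partial>M)"
  shows "\<forall>n \<ge> N. integrable M (\<lambda>\<omega>. (norm (Th n \<omega> - vartheta))\<^sup>2) \<and>
           (\<integral>\<omega>. (norm (Th n \<omega> - vartheta))\<^sup>2 \<partial>M)
             \<le> V (N - 1)
                 * exp ((1 - \<alpha>) * c * \<Gamma> / (1 - lam) * real N powr (1 - lam))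
                 * exp (- ((1 - \<alpha>) * c * \<Gamma> / (1 - lam) * real n powr (1 - lam)))
               + 4 * (2 - \<alpha>) * \<Gamma> * cc\<^sup>2 / ((1 - \<alpha>) * c * real J) * real n powr (- lam)"
proof -
  interpret prob_space M by (rule prob)
  interpret momentum_sgd M J U G \<alpha> \<nu> \<gamma> Th m cc c vartheta
    by unfold_locales (fact J U_indep U_ident G_meas G_int Th_meas m_0 Th_rec m_rec Th0_indep Th0_sq cc_bound cc_sq c_pos c_coercive)+
  define k where "k = (1 - \<alpha>) * c"
  \<comment> \<open>Chosen so that \<open>k / 2 * C\<close> is the noise constant
    \<open>2 * (2 - \<alpha>) * q\<close> of \<open>lyapunov_step\<close> with q = cc^2 / J.\<close>
  define C where "C = 4 * (2 - \<alpha>) * cc\<^sup>2 / (k * real J)"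
  have k: "0 < k" and C: "0 \<le> C" using \<alpha> c_pos J by (auto simp: k_def C_def)
  let ?S = "{2, (2 * (1 + \<alpha>) * c * \<Gamma> / (1 - \<alpha>)) powr (1 / lam),
            (4 * lam / ((1 - \<alpha>) * c * \<Gamma>)) powr (1 / (1 - lam)),
            (2 * (2 - \<alpha>) * (real J - 1 + \<alpha>) * \<Gamma> / ((1 - \<alpha>)\<^sup>2 * c ^ 3 * real J)) powr (1 / lam)}"
  have N_ge: "s \<le> real N" if "s \<in> ?S" for s
  proof -
    have "s \<le> Max ?S" using that by (intro Max_ge) auto
    also have "\<dots> \<le> real N" unfolding N_def by (rule real_nat_ceiling_ge)
    finally show ?thesis .
  qed
  have N2: "2 \<le> N" using N_ge[of 2] by simp
  \<comment> \<open>Turns a threshold for \<open>N\<close> with exponent \<open>1 / lam\<close> into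
    a smallness condition on all later step sizes.\<close>
  have \<gamma>_le: "x * \<gamma> n \<le> 1" if "(x * \<Gamma>) powr (1 / lam) \<le> real N" "0 \<le> x" "n \<ge> N" for x n
  proof -
    have "x * \<Gamma> = ((x * \<Gamma>) powr (1 / lam)) powr lam" using lam \<Gamma>_pos that by (simp add: powr_powr)
    also have "\<dots> \<le> real n powr lam" using that lam by (intro powr_mono2) auto
    finally have "x * \<Gamma> * real n powr (- lam) \<le> real n powr lam * real n powr (- lam)"
      by (intro mult_right_mono) auto
    then show ?thesis using \<gamma>_eq[of n] that N2 by (simp add: mult.assoc flip: powr_add)
  qed
  have small1: "2 * (1 + \<alpha>) * c / (1 - \<alpha>) * \<gamma> n \<le> 1" if "n \<ge> N" for n
    by (rule \<gamma>_le[OF _ _ that]) (use N_ge \<alpha> c_pos in auto)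
  have small2: "2 * (2 - \<alpha>) * (real J - 1 + \<alpha>) / ((1 - \<alpha>)\<^sup>2 * c ^ 3 * real J) * \<gamma> n \<le> 1" if "n \<ge> N" for n
    by (rule \<gamma>_le[OF _ _ that]) (use N_ge \<alpha> c_pos J in auto)
  have g1: "(1 + \<alpha>) * c * \<gamma> n \<le> 1 - \<alpha>" if "n \<ge> N" for n
  proof -
    have "2 * ((1 + \<alpha>) * c * \<gamma> n) \<le> 1 - \<alpha>" using small1[OF that] \<alpha> by (simp add: field_simps)
    moreover have "0 \<le> (1 + \<alpha>) * c * \<gamma> n" using \<alpha> c_pos less_imp_le[OF \<gamma>_pos[of n]] by simp
    ultimately show ?thesis by linarith
  qed
  have V: "V n = err n + (1 + \<alpha>) / (1 - \<alpha>) * \<gamma> n * max (cross n) 0 + 2 / (1 - \<alpha>)\<^sup>2 * (\<gamma> n)\<^sup>2 * mom n" for n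
    by (simp add: V_eq err_def cross_def mom_def)
  have rec: "V n \<le> (1 - k * \<gamma> n) * V (n - 1) + k / 2 * C * (\<gamma> n)\<^sup>2" if n: "n \<ge> N" for n
  proof -
    \<comment> \<open>Because \<open>2 \<le> N\<close>, the previous index is at least 1, so the
      explicit formula holds for both step sizes.\<close>
    obtain l where l: "n = Suc l" "l \<ge> 1" using n N2 by (cases n) auto
    have "\<gamma> (Suc l) \<le> \<gamma> l"
      using l \<gamma>_eq[of l] \<gamma>_eq[of "Suc l"] \<Gamma>_pos lam by (auto intro!: mult_left_mono powr_mono2')
    moreover have "2 * (2 - \<alpha>) * ((real J - 1 + \<alpha>) / real J) * \<gamma> (Suc l) \<le> (1 - \<alpha>)\<^sup>2 * c ^ 3"
    proof -
      have "0 < (1 - \<alpha>)\<^sup>2 * c ^ 3 * real J" using \<alpha> c_pos J by simp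
      then show ?thesis using small2[OF n] J l(1) by (simp add: field_simps)
    qed
    \<comment> \<open>\<open>lyapunov_step\<close> is used with p = (J - 1 + \<alpha>) / J and q =
      cc^2 / J, as supplied by \<open>mom_Suc_le\<close>.\<close>
    ultimately have "V (Suc l) \<le> (1 - (1 - \<alpha>) * c * \<gamma> (Suc l)) * V l + 2 * (2 - \<alpha>) * (\<gamma> (Suc l))\<^sup>2 * (cc\<^sup>2 / real J)"
      unfolding V using \<alpha> J g1[OF n] l(1)
      by (intro lyapunov_step[OF \<alpha> c_pos \<gamma>_pos _ _ drift_le grad_le _ err_Suc cross_Suc _ mom_Suc_le[OF \<alpha>]])
         (auto simp: err_mom_grad_nonneg)
    also have "2 * (2 - \<alpha>) * (\<gamma> (Suc l))\<^sup>2 * (cc\<^sup>2 / real J) = k / 2 * C * (\<gamma> (Suc l))\<^sup>2"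
    proof -
      have "k * C = 4 * (2 - \<alpha>) * cc\<^sup>2 / real J" using k by (simp add: C_def)
      then have "k / 2 * C = 2 * (2 - \<alpha>) * cc\<^sup>2 / real J" using J by (simp add: field_simps)
      then show ?thesis by simp
    qed
    finally show ?thesis using l by (simp add: k_def)
  qed
  have small: "k * \<gamma> n \<le> 1" if "n \<ge> N" for n
  proof -
    have "c * \<gamma> n \<le> (1 + \<alpha>) * c * \<gamma> n" using \<alpha> c_pos less_imp_le[OF \<gamma>_pos[of n]] by (simp add: algebra_simps)
    then have "c * \<gamma> n \<le> 1" using g1[OF that] \<alpha> by linarith
    then have "(1 - \<alpha>) * (c * \<gamma> n) \<le> 1 * 1" using \<alpha> c_pos less_imp_le[OF \<gamma>_pos[of n]] by (intro mult_mono) auto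
    then show ?thesis by (simp add: k_def mult.assoc)
  qed
  have main: "V n \<le> V (N - 1) * exp (k * \<Gamma> / (1 - lam) * real N powr (1 - lam))
      * exp (- (k * \<Gamma> / (1 - lam) * real n powr (1 - lam))) + C * \<gamma> n" if "n \<ge> N" for n
    by (rule polynomial_step_gronwall[OF lam \<Gamma>_pos k C N2 _ \<gamma>_eq small V_nonneg rec that])
       (use N_ge in \<open>auto simp: k_def\<close>)
  show ?thesis
  proof (intro allI impI conjI)
    fix n assume n: "N \<le> n"
    show "integrable M (\<lambda>\<omega>. (norm (Th n \<omega> - vartheta))\<^sup>2)"
      using sq_integrable_diff_const[of n] by (simp add: sq_integrable_def)
    \<comment> \<open>The other two terms of \<open>V n\<close> are nonnegative; the truncation of
      \<open>cross\<close> at 0 secures this.\<close>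
    have "(\<integral>\<omega>. (norm (Th n \<omega> - vartheta))\<^sup>2 \<partial>M) \<le> V n"
      unfolding V using \<alpha> err_mom_grad_nonneg[of n] less_imp_le[OF \<gamma>_pos[of n]] by (simp add: err_def)
    also note main[OF n]
    also have "C * \<gamma> n = 4 * (2 - \<alpha>) * \<Gamma> * cc\<^sup>2 / ((1 - \<alpha>) * c * real J) * real n powr (- lam)"
      using \<gamma>_eq[of n] n N2 by (simp add: C_def k_def)
    finally show "(\<integral>\<omega>. (norm (Th n \<omega> - vartheta))\<^sup>2 \<partial>M)
             \<le> V (N - 1)
                 * exp ((1 - \<alpha>) * c * \<Gamma> / (1 - lam) * real N powr (1 - lam))
                 * exp (- ((1 - \<alpha>) * c * \<Gamma> / (1 - lam) * real n powr (1 - lam)))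
               + 4 * (2 - \<alpha>) * \<Gamma> * cc\<^sup>2 / ((1 - \<alpha>) * c * real J) * real n powr (- lam)"
      unfolding k_def by simp
  qed
qed

end
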